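(* Let $a,b\ge0$ be integers with $a+b\ge1$, and $R>0$. Then for every $\phi\in C_{(a,b),R}$ the function $\mathcal{S}^{a,b}(\phi)$ belongs to $D^{a+b}_R$, and the map $\mathcal{S}^{a,b}:C_{(a,b),R}\to D^{a+b}_R$ is continuous (with respect to the maximum norm on $C_{(a,b),R}$ and $\|\cdot\|_{D^{a+b}}$).
   Context: $C_b((0,\infty))$: continuous functions on $(0,\infty)$ with support bounded above. For $c>0$, $D^{c}_R$ is the set of $\zeta\in C_b((0,\infty))$ with support in $(0,R]$, $\lim_{t\to0}t^c\zeta(t)=0$ and $\lim_{t\to0}\int_t^\infty\zeta(r)r^{c-1}dr$ existing and finite, normed by $\|\zeta\|_{D^c}=\sup_{t>0}t^c|\zeta(t)|+\sup_{t>0}|\int_t^\infty\zeta(r)r^{c-1}dr|$. For $\phi\in C_c([0,\infty)^2)$ and $s,t>0$ define $\tilde{\mathcal{S}}^{a,b}(\phi)[s,t]=\frac{1}{s^{a-1}t^{b-1}}\frac{\partial}{\partial s}\frac{\partial}{\partial t}\Big(s^at^b\int_t^\infty\int_s^\infty\frac{\phi(u,v)}{u^{a+1}v^{b+1}}du\,dv\Big)$, and $\mathcal{S}^{a,b}(\phi)(t)=\tilde{\mathcal{S}}^{a,b}(\phi)[t/\sqrt2,t/\sqrt2]$ for $t>0$. $C_{(a,b),R}$ is the space of $\phi\in C_c([0,\infty)^2)$ supported in $B_R(0)$ such that $\tilde{\mathcal{S}}^{a,b}(\phi)[s,t]$ depends only on $s^2+t^2$ for $s,t>0$, equipped with the maximum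 norm. *)

theory Defs
  imports "HOL-Analysis.Analysis"
begin

definition quadrant :: "(real \<times> real) set" where
  "quadrant = {0..} \<times> {0..}"

definition Cb :: "(real \<Rightarrow> real) set" where
  "Cb = {\<zeta>. continuous_on {0<..} \<zeta> \<and> (\<exists>M. \<forall>t>M. \<zeta> t = 0)}"

definition tailint :: "real \<Rightarrow> (real \<Rightarrow> real) \<Rightarrow> real \<Rightarrow> real" where
  "tailint c \<zeta> t = integral {t..} (\<lambda>r. \<zeta> r * r powr (c - 1))"

text \<open>D^c_R; the support of \<zeta> (closure in (0,\<infinity>) of its nonzero set) lies in (0,R]
  iff \<zeta> vanishes on (R,\<infinity>).\<close>
definition D :: "real \<Rightarrow> real \<Rightarrow> (real \<Rightarrow> real) set" where
  "D c R = {\<zeta>. \<zeta> \<in> Cb \<and> (\<forall>t>R. \<zeta> t = 0)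
              \<and> ((\<lambda>t. t powr c * \<zeta> t) \<longlongrightarrow> 0) (at_right 0)
              \<and> (\<exists>L. (tailint c \<zeta> \<longlongrightarrow> L) (at_right 0))}"

definition Dnorm :: "real \<Rightarrow> (real \<Rightarrow> real) \<Rightarrow> real" where
  "Dnorm c \<zeta> = (SUP t\<in>{0<..}. \<bar>t powr c * \<zeta> t\<bar>) + (SUP t\<in>{0<..}. \<bar>tailint c \<zeta> t\<bar>)"

definition Fab :: "nat \<Rightarrow> nat \<Rightarrow> (real \<times> real \<Rightarrow> real) \<Rightarrow> real \<Rightarrow> real \<Rightarrow> real" where
  "Fab a b \<phi> s t = s ^ a * t ^ b *
     integral {t..} (\<lambda>v. integral {s..} (\<lambda>u. \<phi> (u, v) / (u ^ (a + 1) * v ^ (b + 1))))"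

definition tildeS :: "nat \<Rightarrow> nat \<Rightarrow> (real \<times> real \<Rightarrow> real) \<Rightarrow> real \<Rightarrow> real \<Rightarrow> real" where
  "tildeS a b \<phi> s t = (1 / (s powr (real a - 1) * t powr (real b - 1))) *
     deriv (\<lambda>s'. deriv (\<lambda>t'. Fab a b \<phi> s' t') t) s"

definition SS :: "nat \<Rightarrow> nat \<Rightarrow> (real \<times> real \<Rightarrow> real) \<Rightarrow> real \<Rightarrow> real" where
  "SS a b \<phi> t = tildeS a b \<phi> (t / sqrt 2) (t / sqrt 2)"

definition Cab :: "nat \<Rightarrow> nat \<Rightarrow> real \<Rightarrow> (real \<times> real \<Rightarrow> real) set" where
  "Cab a b R = {\<phi>. continuous_on quadrant \<phi>
      \<and> closure {x\<in>quadrant. \<phi> x \<noteq> 0} \<subseteq> ball 0 R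
      \<and> (\<exists>g. \<forall>s>0. \<forall>t>0. tildeS a b \<phi> s t = g (s\<^sup>2 + t\<^sup>2))}"

definition maxnorm :: "(real \<times> real \<Rightarrow> real) \<Rightarrow> real" where
  "maxnorm \<phi> = (SUP x\<in>quadrant. \<bar>\<phi> x\<bar>)"

end

theory Submission
  imports Defs
begin

text \<open>
  Put \<open>J\<^sub>a f(s) = \<integral>\<^sub>s\<^sup>\<infinity> f(u) u\<^sup>-\<^sup>a\<^sup>-\<^sup>1 du\<close> and \<open>L\<^sub>a f(s) = s\<^sup>-\<^sup>a f(s) - a J\<^sub>a f(s)\<close>. Carrying out the two derivatives
  shows that \<open>tildeS a b\<close> is \<open>L\<^sub>a\<close> in the first variable composed with \<open>L\<^sub>b\<close> in the second, and
  these commute. As \<open>\<bar>s\<^sup>a L\<^sub>a f(s)\<bar> \<le> 2 sup \<bar>f\<bar>\<close> and \<open>s\<^sup>a L\<^sub>a f(s) \<rightarrow> 0\<close> for \<open>a \<ge> 1\<close>, the function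
  \<open>\<zeta> = SS a b \<phi>\<close> satisfies the pointwise bounds of \<open>D\<^sup>c\<close>, \<open>c = a + b\<close>.

  For the tail integral \<open>T(s) = \<integral>\<^sub>s\<^sup>\<infinity> \<zeta>(r) r\<^sup>c\<^sup>-\<^sup>1 dr\<close> assume \<open>a \<ge> 1\<close> by symmetry. Since
  \<open>(s\<^sup>a J\<^sub>a f)' = - s\<^sup>a\<^sup>-\<^sup>1 L\<^sub>a f\<close>, for \<open>b = 0\<close> one gets \<open>T(s) = s\<^sup>a J\<^sub>a \<phi>(\<cdot>,0)(s)\<close>. For \<open>b \<ge> 1\<close>, integrating
  \<open>u\<^sup>a\<^sup>-\<^sup>1 v\<^sup>b\<^sup>-\<^sup>1 \<zeta>(\<surd>(u\<^sup>2+v\<^sup>2))\<close> over the strip \<open>u > s, v > 0\<close> gives \<open>s\<^sup>a J\<^sub>a \<phi>(\<cdot>,0)(s) / b\<close>, while the substitution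
  \<open>v = u x\<close> turns the same integral into an average of the values \<open>T(s \<surd>(1+x\<^sup>2))\<close> with an
  integrable weight. Finally \<open>\<bar>T(s) - T(s q)\<bar> \<le> sup \<bar>r\<^sup>c \<zeta>(r)\<bar> ln q\<close>, so by dominated convergence \<open>T\<close> differs
  from the normalised average by a bounded quantity that tends to \<open>0\<close> with \<open>s\<close>.
\<close>

subsection \<open>Tail integrals in one variable\<close>

lemma integral_tail_cut:
  fixes f :: "real \<Rightarrow> real"
  assumes "\<And>u. u > R \<Longrightarrow> f u = 0"
  shows "integral {s..} f = integral {s..R} f"
proof -
  have "integral UNIV (\<lambda>x. if x \<in> {s..} then f x else 0) = integral UNIV (\<lambda>x. if x \<in> {s..R} then f x else 0)"
    by (rule integral_cong) (use assms in auto)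
  then show ?thesis by (simp only: integral_restrict_UNIV)
qed

lemma integrable_tail:
  fixes f :: "real \<Rightarrow> real"
  assumes "continuous_on {s..} f" "\<And>u. u > R \<Longrightarrow> f u = 0"
  shows "f integrable_on {s..}"
proof -
  have "f integrable_on {s..R}"
    by (rule integrable_continuous_interval, rule continuous_on_subset[OF assms(1)]) auto
  then have "(\<lambda>x. if x \<in> {s..R} then f x else 0) integrable_on UNIV"
    by (simp only: integrable_restrict_UNIV)
  also have "(\<lambda>x. if x \<in> {s..R} then f x else 0) = (\<lambda>x. if x \<in> {s..} then f x else 0)"
    using assms(2) by fastforce
  finally show ?thesis by (simp only: integrable_restrict_UNIV)
qed

lemma integral_tail_eq:
  fixes f :: "real \<Rightarrow> real"
  assumes "\<And>u. u > R \<Longrightarrow> f u = 0" "\<And>u. u > R \<Longrightarrow> Q u = 0" "s > 0"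
    and Q: "\<And>u. u > 0 \<Longrightarrow> (Q has_real_derivative - f u) (at u)"
  shows "integral {s..} f = Q s"
proof -
  \<comment> \<open>Both \<open>f\<close> and \<open>Q\<close> are known to vanish only strictly
    beyond \<open>R\<close>, so the cut has to lie past \<open>R\<close>.\<close>
  define B where "B = max s (R + 1)"
  have "(f has_integral (- Q B - - Q s)) {s..B}"
  proof (rule fundamental_theorem_of_calculus)
    show "s \<le> B" by (simp add: B_def)
    fix x assume "x \<in> {s..B}"
    then have "((\<lambda>u. - Q u) has_real_derivative - (- f x)) (at x)"
      using assms(3) by (intro DERIV_minus Q) auto
    then show "((\<lambda>u. - Q u) has_vector_derivative f x) (at x within {s..B})"
      by (simp add: has_real_derivative_iff_has_vector_derivative has_vector_derivative_at_within)
  qed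
  moreover have "Q B = 0" by (rule assms(2)) (simp add: B_def)
  moreover have "integral {s..} f = integral {s..B} f"
    by (rule integral_tail_cut) (simp add: B_def assms(1))
  ultimately show ?thesis by (simp add: integral_unique)
qed

lemma integral_tail_deriv:
  fixes f :: "real \<Rightarrow> real"
  assumes c: "continuous_on {0<..} f" and z: "\<And>u. u > R \<Longrightarrow> f u = 0" and s: "s > 0"
  shows "((\<lambda>s. integral {s..} f) has_real_derivative - f s) (at s)"
proof -
  \<comment> \<open>The lower end \<open>A = s / 2\<close> stays inside the half-line where
    \<open>f\<close> is continuous; the upper end lies beyond \<open>R\<close>, so near
    \<open>s\<close> the tail integral is a constant minus an integral over a compact
    interval.\<close>
  define B where "B = max (s + 1) (R + 1)"
  define A where "A = s / 2"
  have c': "continuous_on {A..B} f" by (rule continuous_on_subset[OF c]) (use s in \<open>auto simp: A_def\<close>)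
  have "((\<lambda>x. integral {A..x} f) has_real_derivative f s) (at s within {A..B})"
    by (rule integral_has_real_derivative[OF c']) (use s in \<open>auto simp: A_def B_def\<close>)
  then have "((\<lambda>x. integral {A..x} f) has_real_derivative f s) (at s)"
    by (simp add: at_within_Icc_at A_def B_def s)
  then have d: "((\<lambda>x. integral {A..B} f - integral {A..x} f) has_real_derivative - f s) (at s)"
    by (auto intro!: derivative_eq_intros)
  show ?thesis
  proof (rule DERIV_cong_ev[THEN iffD1, OF refl _ refl d])
    have "\<forall>\<^sub>F x in nhds s. x \<in> {A<..<B}"
      by (rule eventually_nhds_in_open) (use s in \<open>auto simp: A_def B_def\<close>)
    then show "\<forall>\<^sub>F x in nhds s. integral {A..B} f - integral {A..x} f = integral {x..} f"
    proof eventually_elim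
      case (elim x)
      have "integral {A..x} f + integral {x..B} f = integral {A..B} f"
        by (rule Henstock_Kurzweil_Integration.integral_combine)
           (use elim integrable_continuous_interval[OF c'] in auto)
      moreover have "integral {x..} f = integral {x..B} f"
        by (rule integral_tail_cut) (use z in \<open>auto simp: B_def\<close>)
      ultimately show ?case by simp
    qed
  qed
qed

section \<open>The one-variable operators and their derivatives\<close>

definition vanishing :: "real \<Rightarrow> (real \<Rightarrow> real) \<Rightarrow> bool" where
  "vanishing R f \<longleftrightarrow> continuous_on {0..} f \<and> (\<forall>u\<ge>R. f u = 0)"

text \<open>\<open>tail_moment a\<close> is the operator \<open>J\<^sub>a\<close> of the overview,
  and \<open>dual_op a\<close> below is \<open>L\<^sub>a\<close>.\<close>

definition tail_moment :: "nat \<Rightarrow> (real \<Rightarrow> real) \<Rightarrow> real \<Rightarrow> real" where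
  "tail_moment a f s = integral {s..} (\<lambda>u. f u / u ^ (a + 1))"

definition dual_op :: "nat \<Rightarrow> (real \<Rightarrow> real) \<Rightarrow> real \<Rightarrow> real" where
  "dual_op a f s = f s / s ^ a - real a * tail_moment a f s"

lemma vanishing_cont: "vanishing R f \<Longrightarrow> continuous_on {0<..} f"
  unfolding vanishing_def by (auto intro: continuous_on_subset)

lemma tail_moment_integrable:
  assumes "vanishing R f" "s > 0"
  shows "(\<lambda>u. f u / u ^ (a + 1)) integrable_on {s..}"
proof (rule integrable_tail[where R = R])
  show "continuous_on {s..} (\<lambda>u. f u / u ^ (a + 1))"
    using assms unfolding vanishing_def
    by (intro continuous_intros) (auto intro: continuous_on_subset)
qed (use assms in \<open>auto simp: vanishing_def\<close>)

lemma tail_moment_cut: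
  assumes "vanishing R f"
  shows "tail_moment a f s = integral {s..R} (\<lambda>u. f u / u ^ (a + 1))"
  unfolding tail_moment_def by (rule integral_tail_cut) (use assms in \<open>auto simp: vanishing_def\<close>)

lemma tail_moment_zero: "vanishing R f \<Longrightarrow> s \<ge> R \<Longrightarrow> tail_moment a f s = 0"
  by (cases "s = R") (simp_all add: tail_moment_cut)

lemma tail_moment_deriv:
  assumes "vanishing R f" "s > 0"
  shows "(tail_moment a f has_real_derivative - (f s / s ^ (a + 1))) (at s)"
proof -
  have "continuous_on {0<..} (\<lambda>u. f u / u ^ (a + 1))"
    by (intro continuous_intros vanishing_cont[OF assms(1)]) auto
  from integral_tail_deriv[OF this, of R s] assms show ?thesis
    unfolding tail_moment_def by (simp add: vanishing_def)
qed

lemma tail_moment_cont: "vanishing R f \<Longrightarrow> continuous_on {0<..} (tail_moment a f)"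
  by (intro DERIV_continuous_on) (auto intro: has_field_derivative_at_within tail_moment_deriv)

lemma dual_op_cont: "vanishing R f \<Longrightarrow> continuous_on {0<..} (dual_op a f)"
  unfolding dual_op_def by (intro continuous_intros tail_moment_cont vanishing_cont) auto

lemma dual_op_zero: "vanishing R f \<Longrightarrow> s \<ge> R \<Longrightarrow> dual_op a f s = 0"
  by (simp add: dual_op_def tail_moment_zero) (simp add: vanishing_def)

text \<open>The product rule. The factor \<open>s ^ a / s\<close> stands for the power
  \<open>a - 1\<close> and stays correct at \<open>a = 0\<close>, where natural subtraction would be
  truncated.\<close>

lemma power_tail_moment_deriv:
  assumes "vanishing R f" "s > 0"
  shows "((\<lambda>s. s ^ a * tail_moment a f s) has_real_derivative - (s ^ a / s * dual_op a f s)) (at s)"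
proof -
  have "((\<lambda>s. s ^ a * tail_moment a f s) has_real_derivative
      (real a * s ^ (a - 1)) * tail_moment a f s + - (f s / s ^ (a + 1)) * s ^ a) (at s)"
    by (rule DERIV_mult[OF _ tail_moment_deriv[OF assms]]) (auto intro!: derivative_eq_intros)
  also have "(real a * s ^ (a - 1)) * tail_moment a f s + - (f s / s ^ (a + 1)) * s ^ a = - (s ^ a / s * dual_op a f s)"
    using assms(2) by (cases a) (auto simp: dual_op_def field_simps)
  finally show ?thesis .
qed

lemma integral_dual_op:
  assumes "vanishing R f" "s > 0"
  shows "integral {s..} (\<lambda>u. u ^ a / u * dual_op a f u) = s ^ a * tail_moment a f s"
  by (rule integral_tail_eq[where R = R]) (use assms power_tail_moment_deriv in \<open>simp_all add: tail_moment_zero dual_op_zero\<close>)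

lemma tail_moment_lin:
  assumes "vanishing R f" "vanishing R g" "s > 0"
  shows "tail_moment a (\<lambda>u. x * f u + y * g u) s = x * tail_moment a f s + y * tail_moment a g s"
proof -
  have "tail_moment a (\<lambda>u. x * f u + y * g u) s = integral {s..} (\<lambda>u. x * (f u / u ^ (a+1)) + y * (g u / u ^ (a+1)))"
    unfolding tail_moment_def by (simp add: add_divide_distrib)
  also have "\<dots> = x * tail_moment a f s + y * tail_moment a g s"
    unfolding tail_moment_def using tail_moment_integrable[OF assms(1,3)] tail_moment_integrable[OF assms(2,3)]
    by (subst integral_add) (auto simp only: integral_mult_right intro: integrable_on_mult_right)
  finally show ?thesis .
qed

lemma vanishing_lin: "vanishing R f \<Longrightarrow> vanishing R g \<Longrightarrow> vanishing R (\<lambda>u. x * f u + y * g u)"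
  unfolding vanishing_def by (auto intro!: continuous_intros)

lemma dual_op_lin:
  assumes "vanishing R f" "vanishing R g" "s > 0"
  shows "dual_op a (\<lambda>u. x * f u + y * g u) s = x * dual_op a f s + y * dual_op a g s"
  unfolding dual_op_def tail_moment_lin[OF assms] using assms by (simp add: field_simps)

section \<open>Weighted averages over half-lines and their limit at zero\<close>

lemma has_integral_inverse_power:
  assumes "0 < s" "s \<le> t" "a \<ge> 1"
  shows "((\<lambda>u::real. real a / u ^ (a + 1)) has_integral (1 / s ^ a - 1 / t ^ a)) {s..t}"
proof -
  have "((\<lambda>u::real. real a / u ^ (a + 1)) has_integral (- (1 / t ^ a) - - (1 / s ^ a))) {s..t}"
  proof (rule fundamental_theorem_of_calculus)
    fix x assume "x \<in> {s..t}"
    then have "x > 0" using assms by auto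
    then have "((\<lambda>u. - (1 / u ^ a)) has_real_derivative real a / x ^ (a + 1)) (at x)"
      using assms(3) by (auto intro!: derivative_eq_intros simp: field_simps simp flip: power_Suc power_add)
    then show "((\<lambda>u. - (1 / u ^ a)) has_vector_derivative real a / x ^ (a + 1)) (at x within {s..t})"
      by (simp add: has_real_derivative_iff_has_vector_derivative has_vector_derivative_at_within)
  qed (use assms in auto)
  then show ?thesis by simp
qed

lemma weighted_integral_bound:
  fixes f :: "real \<Rightarrow> real"
  assumes "0 < s" "s \<le> t" "a \<ge> 1" "continuous_on {s..t} f" "\<And>u. u \<in> {s..t} \<Longrightarrow> \<bar>f u\<bar> \<le> M"
  shows "\<bar>real a * integral {s..t} (\<lambda>u. f u / u ^ (a + 1))\<bar> \<le> M * (1 / s ^ a - 1 / t ^ a)"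
proof -
  have i: "((\<lambda>u. M * (real a / u ^ (a + 1))) has_integral M * (1 / s ^ a - 1 / t ^ a)) {s..t}"
    by (intro has_integral_mult_right has_integral_inverse_power assms)
  have "norm (integral {s..t} (\<lambda>u. real a * (f u / u ^ (a + 1)))) \<le> integral {s..t} (\<lambda>u. M * (real a / u ^ (a + 1)))"
  proof (rule integral_norm_bound_integral)
    show "(\<lambda>u. real a * (f u / u ^ (a + 1))) integrable_on {s..t}"
      by (intro integrable_continuous_interval continuous_intros assms(4)) (use assms in auto)
    fix x assume x: "x \<in> {s..t}"
    have "norm (real a * (f x / x ^ (a + 1))) = \<bar>f x\<bar> * (real a / x ^ (a + 1))"
      using x assms(1) by (simp add: abs_mult)
    also have "\<dots> \<le> M * (real a / x ^ (a + 1))"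
      by (rule mult_right_mono) (use x assms in auto)
    finally show "norm (real a * (f x / x ^ (a + 1))) \<le> M * (real a / x ^ (a + 1))" .
  qed (use i in blast)
  then show ?thesis by (simp only: integral_unique[OF has_integral_inverse_power[OF assms(1-3)]] integral_mult_right real_norm_def)
qed

text \<open>For \<open>a \<ge> 1\<close> the density \<open>a * s^a / u^(a+1)\<close> has mass 1 on
  the half-line from \<open>s\<close>, so the left-hand side is the modulus of an average of
  \<open>f\<close>.\<close>

lemma tail_moment_bound:
  assumes f: "vanishing R f" and s: "s > 0" and M: "\<And>u. u \<ge> s \<Longrightarrow> \<bar>f u\<bar> \<le> M"
  shows "\<bar>real a * (s ^ a * tail_moment a f s)\<bar> \<le> M"
proof -
  have M0: "M \<ge> 0" using M[of s] by auto
  show ?thesis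
  proof (cases "a = 0 \<or> s \<ge> R")
    case True
    then show ?thesis using M0 tail_moment_zero[OF f] by auto
  next
    case False
    then have *: "a \<ge> 1" "s < R" by auto
    have "\<bar>real a * integral {s..R} (\<lambda>u. f u / u ^ (a + 1))\<bar> \<le> M * (1 / s ^ a - 1 / R ^ a)"
      by (rule weighted_integral_bound) (use * s f M in \<open>auto simp: vanishing_def intro: continuous_on_subset\<close>)
    also have "\<dots> \<le> M * (1 / s ^ a)"
      by (rule mult_left_mono) (use M0 * s in auto)
    finally have "\<bar>real a * tail_moment a f s\<bar> \<le> M / s ^ a" by (simp add: tail_moment_cut[OF f])
    then have "s ^ a * \<bar>real a * tail_moment a f s\<bar> \<le> M" using s by (simp add: field_simps)
    moreover have "\<bar>real a * (s ^ a * tail_moment a f s)\<bar> = s ^ a * \<bar>real a * tail_moment a f s\<bar>"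
      using s by (simp add: abs_mult)
    ultimately show ?thesis by simp
  qed
qed

lemma power_dual_op_eq: "s > 0 \<Longrightarrow> s ^ a * dual_op a f s = f s - real a * (s ^ a * tail_moment a f s)"
  by (simp add: dual_op_def field_simps)

lemma dual_op_bound:
  assumes f: "vanishing R f" and s: "s > 0" and M: "\<And>u. u \<ge> s \<Longrightarrow> \<bar>f u\<bar> \<le> M"
  shows "\<bar>s ^ a * dual_op a f s\<bar> \<le> 2 * M"
  using tail_moment_bound[OF assms, where a=a] M[of s] unfolding power_dual_op_eq[OF s] by auto

text \<open>The averaging density puts mass \<open>1 - (s/d)^a\<close> on \<open>{s..d}\<close>,
  where \<open>f\<close> is within \<open>e\<close> of \<open>f 0\<close>, and mass
  \<open>(s/d)^a\<close> beyond. There \<open>f\<close> and \<open>f 0\<close> are each bounded by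
  \<open>M\<close>, whence the factor 2.\<close>

lemma tail_moment_near_zero:
  assumes f: "vanishing R f" and s: "0 < s" "s \<le> d" and a: "a \<ge> 1"
    and M: "\<And>u. u \<ge> 0 \<Longrightarrow> \<bar>f u\<bar> \<le> M" and e: "\<And>u. 0 \<le> u \<Longrightarrow> u \<le> d \<Longrightarrow> \<bar>f u - f 0\<bar> \<le> e"
  shows "\<bar>real a * (s ^ a * tail_moment a f s) - f 0\<bar> \<le> e + 2 * M * (s / d) ^ a"
proof -
  have e0: "e \<ge> 0" using e[of 0] s by auto
  have c: "continuous_on {s..d} f" using f s unfolding vanishing_def by (auto intro: continuous_on_subset)
  define I1 where "I1 = real a * integral {s..d} (\<lambda>u. (f u - f 0) / u ^ (a + 1))"
  have I1: "\<bar>I1\<bar> \<le> e * (1 / s ^ a - 1 / d ^ a)" unfolding I1_def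
    by (rule weighted_integral_bound) (use s a c e in \<open>auto intro!: continuous_intros\<close>)
  have d: "d > 0" using s by auto
  \<comment> \<open>Ending the integrals from \<open>s\<close> and from \<open>d\<close> at
    \<open>max d R\<close> covers the case \<open>d > R\<close> as well.\<close>
  have "tail_moment a f s = integral {s..max d R} (\<lambda>u. f u / u ^ (a + 1))" for s
    unfolding tail_moment_def by (rule integral_tail_cut) (use f in \<open>auto simp: vanishing_def\<close>)
  moreover have "integral {s..d} (\<lambda>u. f u / u ^ (a + 1)) + integral {d..max d R} (\<lambda>u. f u / u ^ (a + 1))
     = integral {s..max d R} (\<lambda>u. f u / u ^ (a + 1))"
  proof (rule Henstock_Kurzweil_Integration.integral_combine)
    have "continuous_on {s..max d R} f" using f s unfolding vanishing_def by (auto intro: continuous_on_subset)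
    then show "(\<lambda>u. f u / u ^ (a + 1)) integrable_on {s..max d R}"
      by (intro integrable_continuous_interval continuous_intros) (use s in auto)
  qed (use s in auto)
  ultimately have split: "tail_moment a f s = integral {s..d} (\<lambda>u. f u / u ^ (a + 1)) + tail_moment a f d" by simp
  have "I1 = integral {s..d} (\<lambda>u. real a * (f u / u ^ (a + 1)) - f 0 * (real a / u ^ (a + 1)))"
    unfolding I1_def integral_mult_right[symmetric] by (simp add: diff_divide_distrib right_diff_distrib mult.commute)
  also have "\<dots> = real a * integral {s..d} (\<lambda>u. f u / u ^ (a + 1)) - f 0 * (1 / s ^ a - 1 / d ^ a)"
  proof (subst integral_diff)
    show "(\<lambda>u. real a * (f u / u ^ (a + 1))) integrable_on {s..d}"
      by (intro integrable_continuous_interval continuous_intros c) (use s in auto)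
    show "(\<lambda>u. f 0 * (real a / u ^ (a + 1))) integrable_on {s..d}"
      by (intro integrable_continuous_interval continuous_intros) (use s in auto)
  qed (simp only: integral_unique[OF has_integral_inverse_power[OF s a]] integral_mult_right)
  finally have "real a * tail_moment a f s = I1 + f 0 * (1 / s ^ a - 1 / d ^ a) + real a * tail_moment a f d"
    unfolding split by (simp add: algebra_simps)
  then have "s ^ a * (real a * tail_moment a f s) = s ^ a * I1 + f 0 - f 0 * (s / d) ^ a + s ^ a * (real a * tail_moment a f d)"
    using s d by (simp add: field_simps)
  then have E: "real a * (s ^ a * tail_moment a f s) - f 0 = s ^ a * I1 - f 0 * (s / d) ^ a + (s / d) ^ a * (real a * (d ^ a * tail_moment a f d))"
    using s d by (simp add: field_simps)
  have q: "(s / d) ^ a \<ge> 0" using s d by simp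
  have "\<bar>s ^ a * I1\<bar> \<le> e"
  proof -
    have "\<bar>s ^ a * I1\<bar> = s ^ a * \<bar>I1\<bar>" using s by (simp add: abs_mult)
    also have "\<dots> \<le> s ^ a * (e * (1 / s ^ a - 1 / d ^ a))" using I1 s by (intro mult_left_mono) auto
    also have "\<dots> = e - e * (s / d) ^ a" using s d by (simp add: field_simps)
    also have "\<dots> \<le> e" using e0 q by simp
    finally show ?thesis .
  qed
  moreover have "\<bar>f 0 * (s / d) ^ a\<bar> \<le> M * (s / d) ^ a"
    unfolding abs_mult abs_of_nonneg[OF q] by (rule mult_right_mono[OF M q]) simp
  moreover have "\<bar>(s / d) ^ a * (real a * (d ^ a * tail_moment a f d))\<bar> \<le> (s / d) ^ a * M"
    unfolding abs_mult[of "(s/d)^a"] abs_of_nonneg[OF q] by (rule mult_left_mono[OF tail_moment_bound[OF f d M] q]) (use d in auto)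
  ultimately show ?thesis unfolding E by (simp add: algebra_simps)
qed

lemma vanishing_bounded:
  assumes "vanishing R f"
  obtains M where "M \<ge> 1" "\<And>u. u \<ge> 0 \<Longrightarrow> \<bar>f u\<bar> \<le> M"
proof -
  have "compact (f ` {0..R})"
    by (rule compact_continuous_image) (use assms in \<open>auto simp: vanishing_def intro: continuous_on_subset\<close>)
  then have "bounded (f ` {0..R})" by (rule compact_imp_bounded)
  then obtain B where B: "B > 0" "\<And>x. x \<in> {0..R} \<Longrightarrow> \<bar>f x\<bar> \<le> B"
    unfolding bounded_pos by auto
  show ?thesis
  proof (rule that[of "max 1 B"])
    fix u :: real assume "u \<ge> 0"
    then show "\<bar>f u\<bar> \<le> max 1 B"
      using B(2)[of u] assms by (cases "u \<le> R") (auto simp: vanishing_def)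
  qed simp
qed

text \<open>The radius \<open>d'\<close> depends on \<open>a\<close>, \<open>M\<close>,
  \<open>e\<close>, \<open>d\<close> only, not on \<open>f\<close>: the quantifiers are arranged so
  that one \<open>d'\<close> serves all slices of a function on the quadrant.\<close>

lemma tail_moment_near_zero_uniform:
  assumes a: "a \<ge> 1" and M1: "M \<ge> 1" and e: "e > 0" and d: "d > 0"
  obtains d' where "d' > 0" "d' \<le> d"
    "\<And>R f s. vanishing R f \<Longrightarrow> (\<And>u. u \<ge> 0 \<Longrightarrow> \<bar>f u\<bar> \<le> M)
       \<Longrightarrow> (\<And>u. 0 \<le> u \<Longrightarrow> u \<le> d \<Longrightarrow> \<bar>f u - f 0\<bar> \<le> e) \<Longrightarrow> 0 < s \<Longrightarrow> s \<le> d'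
       \<Longrightarrow> \<bar>real a * (s ^ a * tail_moment a f s) - f 0\<bar> \<le> 2 * e"
proof -
  \<comment> \<open>For \<open>s \<le> d'\<close> this gives \<open>s / d \<le> e / (2 * M)\<close>;
    since \<open>s / d \<le> 1\<close> and \<open>a \<ge> 1\<close>, the error
    \<open>2 * M * (s / d) ^ a\<close> is then at most \<open>e\<close>.\<close>
  define d' where "d' = min d (d * (e / (2 * M)))"
  have d': "d' > 0" "d' \<le> d" using d e M1 by (auto simp: d'_def)
  show ?thesis
  proof (rule that[OF d'])
    fix R f s
    assume f: "vanishing R f" "\<And>u. u \<ge> 0 \<Longrightarrow> \<bar>f u\<bar> \<le> M" "\<And>u. 0 \<le> u \<Longrightarrow> u \<le> d \<Longrightarrow> \<bar>f u - f 0\<bar> \<le> e"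
      and s: "0 < s" "s \<le> d'"
    have "\<bar>real a * (s ^ a * tail_moment a f s) - f 0\<bar> \<le> e + 2 * M * (s / d) ^ a"
      by (rule tail_moment_near_zero[OF f(1)]) (use f s d' a in auto)
    moreover have "(s / d) ^ a \<le> (s / d) ^ 1"
      by (rule power_decreasing) (use a s d d' in auto)
    moreover have "s / d \<le> e / (2 * M)"
      using s d by (simp add: d'_def field_simps)
    ultimately have "2 * M * (s / d) ^ a \<le> 2 * M * (e / (2 * M))"
      using M1 by (intro mult_left_mono) auto
    then show "\<bar>real a * (s ^ a * tail_moment a f s) - f 0\<bar> \<le> 2 * e"
      using \<open>_ \<le> e + _\<close> M1 by simp
  qed
qed

text \<open>As \<open>s\<close> tends to 0 the averaging density concentrates at 0, where
  \<open>f\<close> is continuous.\<close>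

lemma tail_moment_tendsto:
  assumes f: "vanishing R f" and a: "a \<ge> 1"
  shows "((\<lambda>s. s ^ a * tail_moment a f s) \<longlongrightarrow> f 0 / real a) (at_right 0)"
proof -
  have "((\<lambda>s. real a * (s ^ a * tail_moment a f s)) \<longlongrightarrow> f 0) (at_right 0)"
  proof (rule tendstoI)
    fix e :: real assume e: "e > 0"
    obtain M where M: "M \<ge> 1" "\<And>u. u \<ge> 0 \<Longrightarrow> \<bar>f u\<bar> \<le> M" by (rule vanishing_bounded[OF f]) blast
    have "\<exists>d>0. \<forall>u\<in>{0..}. dist u 0 < d \<longrightarrow> dist (f u) (f 0) < e / 4"
      using f e unfolding vanishing_def continuous_on_iff by (metis atLeast_iff order_refl zero_less_divide_iff zero_less_numeral)
    then obtain d0 where d0: "d0 > 0" "\<And>u. u \<ge> 0 \<Longrightarrow> u < d0 \<Longrightarrow> \<bar>f u - f 0\<bar> < e / 4"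
      by (auto simp: dist_real_def)
    obtain d where d: "d > 0" "\<And>R f s. vanishing R f \<Longrightarrow> (\<And>u. u \<ge> 0 \<Longrightarrow> \<bar>f u\<bar> \<le> M)
       \<Longrightarrow> (\<And>u. 0 \<le> u \<Longrightarrow> u \<le> d0 / 2 \<Longrightarrow> \<bar>f u - f 0\<bar> \<le> e / 4) \<Longrightarrow> 0 < s \<Longrightarrow> s \<le> d
       \<Longrightarrow> \<bar>real a * (s ^ a * tail_moment a f s) - f 0\<bar> \<le> 2 * (e / 4)"
      using tail_moment_near_zero_uniform[OF a M(1), of "e / 4" "d0 / 2"] e d0(1) by (metis half_gt_zero zero_less_divide_iff zero_less_numeral)
    have "\<forall>\<^sub>F s in at_right 0. s \<in> {0<..<d}"
      using d(1) by (auto simp: eventually_at_right_field)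
    then show "\<forall>\<^sub>F s in at_right 0. dist (real a * (s ^ a * tail_moment a f s)) (f 0) < e"
    proof eventually_elim
      case (elim s)
      have "\<bar>real a * (s ^ a * tail_moment a f s) - f 0\<bar> \<le> 2 * (e / 4)"
        by (rule d(2)[OF f M(2)]) (use elim d0 in \<open>auto intro!: less_imp_le\<close>)
      then show ?case using e by (simp add: dist_real_def)
    qed
  qed
  from tendsto_divide[OF this tendsto_const, of "real a"] show ?thesis using a by simp
qed

subsection \<open>Functions on the quadrant\<close>

text \<open>Vanishing is required off a square: this is what makes all slices in either variable
  \<open>vanishing\<close> with the same \<open>R\<close>.\<close>

definition vanishing2 :: "real \<Rightarrow> (real \<times> real \<Rightarrow> real) \<Rightarrow> bool" where
  "vanishing2 R \<phi> \<longleftrightarrow> R > 0 \<and> continuous_on quadrant \<phi> \<and> (\<forall>u\<ge>0. \<forall>v\<ge>0. u \<ge> R \<or> v \<ge> R \<longrightarrow> \<phi> (u, v) = 0)"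

lemma vanishing2_swap:
  assumes "vanishing2 R \<phi>" shows "vanishing2 R (\<phi> \<circ> prod.swap)"
proof -
  have "continuous_on quadrant (\<phi> \<circ> prod.swap)"
    using assms unfolding vanishing2_def quadrant_def comp_def
    by (intro continuous_on_compose2[of _ \<phi> _ prod.swap]) (auto intro!: continuous_intros)
  then show ?thesis using assms by (auto simp: vanishing2_def)
qed

lemma vanishing2_slice_fst: "vanishing2 R \<phi> \<Longrightarrow> v \<ge> 0 \<Longrightarrow> vanishing R (\<lambda>u. \<phi> (u, v))"
  unfolding vanishing2_def vanishing_def quadrant_def
  by (auto intro!: continuous_on_compose2[of _ \<phi> _ "\<lambda>u. (u, v)"] continuous_intros)

lemma vanishing2_slice_snd: "vanishing2 R \<phi> \<Longrightarrow> u \<ge> 0 \<Longrightarrow> vanishing R (\<lambda>v. \<phi> (u, v))"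
  using vanishing2_slice_fst[OF vanishing2_swap, of R \<phi> u] by simp

text \<open>Cut at \<open>R\<close>, the integral runs over a compact interval away from the
  singularity of the weight at 0, so it depends continuously on the parameter
  \<open>u\<close>.\<close>

lemma vanishing_tail_moment_snd:
  assumes "vanishing2 R \<phi>" "t > 0"
  shows "vanishing R (\<lambda>u. tail_moment b (\<lambda>v. \<phi> (u, v)) t)"
proof -
  have "continuous_on ({0..} \<times> cbox t R) (\<lambda>(u, v). \<phi> (u, v) / v ^ (b + 1))"
    unfolding case_prod_unfold prod.collapse
    using assms by (intro continuous_intros) (auto simp: vanishing2_def quadrant_def intro: continuous_on_subset)
  from integral_continuous_on_param[OF this]
  have "continuous_on {0..} (\<lambda>u. integral {t..R} (\<lambda>v. \<phi> (u, v) / v ^ (b + 1)))" by simp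
  also have "?this \<longleftrightarrow> continuous_on {0..} (\<lambda>u. tail_moment b (\<lambda>v. \<phi> (u, v)) t)"
    by (rule continuous_on_cong) (simp_all add: tail_moment_cut[OF vanishing2_slice_snd[OF assms(1)]])
  finally have "continuous_on {0..} (\<lambda>u. tail_moment b (\<lambda>v. \<phi> (u, v)) t)" .
  moreover have "tail_moment b (\<lambda>v. \<phi> (u, v)) t = 0" if "u \<ge> R" for u
  proof -
    have "integral {t..} (\<lambda>v. \<phi> (u, v) / v ^ (b + 1)) = integral {t..} (\<lambda>v. 0)"
    proof (rule integral_cong)
      fix v assume "v \<in> {t..}"
      then show "\<phi> (u, v) / v ^ (b + 1) = 0"
        using that assms by (auto simp: vanishing2_def)
    qed
    then show ?thesis by (simp add: tail_moment_def)
  qed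
  ultimately show ?thesis by (simp add: vanishing_def)
qed

lemma vanishing_tail_moment_fst: "vanishing2 R \<phi> \<Longrightarrow> s > 0 \<Longrightarrow> vanishing R (\<lambda>v. tail_moment a (\<lambda>u. \<phi> (u, v)) s)"
  using vanishing_tail_moment_snd[OF vanishing2_swap] by simp

text \<open>With both tails cut at \<open>R\<close> this is Fubini for a continuous function on a
  compact rectangle.\<close>

lemma tail_moment_swap:
  assumes "vanishing2 R \<phi>" "s > 0" "t > 0"
  shows "tail_moment b (\<lambda>v. tail_moment a (\<lambda>u. \<phi> (u, v)) s) t = tail_moment a (\<lambda>u. tail_moment b (\<lambda>v. \<phi> (u, v)) t) s"
proof -
  have "continuous_on (cbox (s, t) (R, R)) (\<lambda>(u, v). \<phi> (u, v) / (u ^ (a + 1) * v ^ (b + 1)))"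
    unfolding case_prod_unfold prod.collapse
    using assms by (intro continuous_intros)
      (auto simp: vanishing2_def quadrant_def cbox_Pair_eq intro: continuous_on_subset)
  from integral_swap_continuous[OF this]
  have *: "integral {s..R} (\<lambda>u. integral {t..R} (\<lambda>v. \<phi> (u, v) / (u ^ (a + 1) * v ^ (b + 1))))
      = integral {t..R} (\<lambda>v. integral {s..R} (\<lambda>u. \<phi> (u, v) / (u ^ (a + 1) * v ^ (b + 1))))"
    by simp
  have "tail_moment a (\<lambda>u. tail_moment b (\<lambda>v. \<phi> (u, v)) t) s =
      integral {s..R} (\<lambda>u. integral {t..R} (\<lambda>v. \<phi> (u, v) / (u ^ (a + 1) * v ^ (b + 1))))"
    unfolding tail_moment_cut[OF vanishing_tail_moment_snd[OF assms(1,3)]]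
  proof (rule integral_cong)
    fix u assume "u \<in> {s..R}"
    then have "tail_moment b (\<lambda>v. \<phi> (u, v)) t = integral {t..R} (\<lambda>v. \<phi> (u, v) / v ^ (b + 1))"
      using assms(2) by (intro tail_moment_cut[OF vanishing2_slice_snd[OF assms(1)]]) auto
    then show "tail_moment b (\<lambda>v. \<phi> (u, v)) t / u ^ (a + 1)
        = integral {t..R} (\<lambda>v. \<phi> (u, v) / (u ^ (a + 1) * v ^ (b + 1)))"
      by (simp only: integral_divide[symmetric]) (simp add: mult.commute)
  qed
  moreover have "tail_moment b (\<lambda>v. tail_moment a (\<lambda>u. \<phi> (u, v)) s) t =
      integral {t..R} (\<lambda>v. integral {s..R} (\<lambda>u. \<phi> (u, v) / (u ^ (a + 1) * v ^ (b + 1))))"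
    unfolding tail_moment_cut[OF vanishing_tail_moment_fst[OF assms(1,2)]]
  proof (rule integral_cong)
    fix v assume "v \<in> {t..R}"
    then have "tail_moment a (\<lambda>u. \<phi> (u, v)) s = integral {s..R} (\<lambda>u. \<phi> (u, v) / u ^ (a + 1))"
      using assms(3) by (intro tail_moment_cut[OF vanishing2_slice_fst[OF assms(1)]]) auto
    then show "tail_moment a (\<lambda>u. \<phi> (u, v)) s / v ^ (b + 1)
        = integral {s..R} (\<lambda>u. \<phi> (u, v) / (u ^ (a + 1) * v ^ (b + 1)))"
      by (simp only: integral_divide[symmetric]) simp
  qed
  ultimately show ?thesis using * by simp
qed

lemma vanishing_dual_op_snd:
  assumes "vanishing2 R \<phi>" "t > 0"
  shows "vanishing R (\<lambda>u. dual_op b (\<lambda>v. \<phi> (u, v)) t)"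
  using vanishing_lin[OF vanishing2_slice_fst[OF assms(1), of t] vanishing_tail_moment_snd[OF assms, of b], of "1 / t ^ b" "- real b"] assms(2)
  by (simp add: dual_op_def)

lemma vanishing_dual_op_fst: "vanishing2 R \<phi> \<Longrightarrow> s > 0 \<Longrightarrow> vanishing R (\<lambda>v. dual_op a (\<lambda>u. \<phi> (u, v)) s)"
  using vanishing_dual_op_snd[OF vanishing2_swap] by simp

lemma tail_moment_dual_op:
  assumes "vanishing2 R \<phi>" "s > 0" "t > 0"
  shows "tail_moment a (\<lambda>u. dual_op b (\<lambda>v. \<phi> (u, v)) t) s = dual_op b (\<lambda>v. tail_moment a (\<lambda>u. \<phi> (u, v)) s) t"
  using tail_moment_lin[OF vanishing2_slice_fst[OF assms(1), of t] vanishing_tail_moment_snd[OF assms(1,3), of b] assms(2), of a "1 / t ^ b" "- real b"]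
    assms(3)
  by (simp add: dual_op_def tail_moment_swap[OF assms])

lemma dual_op_swap:
  assumes "vanishing2 R \<phi>" "s > 0" "t > 0"
  shows "dual_op b (\<lambda>v. dual_op a (\<lambda>u. \<phi> (u, v)) s) t = dual_op a (\<lambda>u. dual_op b (\<lambda>v. \<phi> (u, v)) t) s"
  using dual_op_lin[OF vanishing2_slice_snd[OF assms(1), of s] vanishing_tail_moment_fst[OF assms(1,2), of a] assms(3), of b "1 / s ^ a" "- real a"]
    assms(2)
  by (simp add: dual_op_def[of a] tail_moment_dual_op[OF assms])

text \<open>The inner derivative turns \<open>t^b * tail_moment b\<close> into
  \<open>- t^(b-1) * dual_op b\<close>, which commutes with \<open>tail_moment a\<close>; the outer
  derivative does the same in \<open>s\<close>. The signs cancel, and the prefactor removes the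
  remaining powers.\<close>

lemma tildeS_eq:
  assumes "vanishing2 R \<phi>" "s > 0" "t > 0"
  shows "tildeS a b \<phi> s t = dual_op a (\<lambda>u. dual_op b (\<lambda>v. \<phi> (u, v)) t) s"
proof -
  define K where "K = (\<lambda>u. dual_op b (\<lambda>v. \<phi> (u, v)) t)"
  have K: "vanishing R K" unfolding K_def by (rule vanishing_dual_op_snd[OF assms(1,3)])
  have F: "Fab a b \<phi> x y = x ^ a * (y ^ b * tail_moment b (\<lambda>v. tail_moment a (\<lambda>u. \<phi> (u, v)) x) y)" for x y
  proof -
    have "integral {x..} (\<lambda>u. \<phi> (u, v) / (u ^ (a + 1) * v ^ (b + 1))) = tail_moment a (\<lambda>u. \<phi> (u, v)) x / v ^ (b + 1)" for v
      unfolding tail_moment_def integral_divide[symmetric] by simp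
    then show ?thesis by (simp add: Fab_def tail_moment_def[of b])
  qed
  have inner: "deriv (\<lambda>y. Fab a b \<phi> x y) t = - (t ^ b / t) * (x ^ a * tail_moment a K x)" if "x > 0" for x
  proof (rule DERIV_imp_deriv)
    show "((\<lambda>y. Fab a b \<phi> x y) has_real_derivative - (t ^ b / t) * (x ^ a * tail_moment a K x)) (at t)"
      unfolding F K_def tail_moment_dual_op[OF assms(1) that assms(3)]
      by (rule DERIV_cong[OF DERIV_cmult[OF power_tail_moment_deriv[OF vanishing_tail_moment_fst[OF assms(1) that] assms(3)]]]) simp
  qed
  have "((\<lambda>x. - (t ^ b / t) * (x ^ a * tail_moment a K x)) has_real_derivative (t ^ b / t) * (s ^ a / s) * dual_op a K s) (at s)"
    by (rule DERIV_cong[OF DERIV_cmult[OF power_tail_moment_deriv[OF K assms(2)]]]) simp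
  \<comment> \<open>The formula \<open>inner\<close> holds for \<open>x > 0\<close>, a neighbourhood
    of \<open>s\<close>, which is enough for the derivative at \<open>s\<close>.\<close>
  moreover have "\<forall>\<^sub>F x in nhds s. - (t ^ b / t) * (x ^ a * tail_moment a K x) = deriv (\<lambda>y. Fab a b \<phi> x y) t"
    using eventually_nhds_in_open[of "{0<..}" s] assms(2) by (auto elim!: eventually_mono simp: inner)
  ultimately have "((\<lambda>x. deriv (\<lambda>y. Fab a b \<phi> x y) t) has_real_derivative (t ^ b / t) * (s ^ a / s) * dual_op a K s) (at s)"
    by (rule DERIV_cong_ev[THEN iffD1, OF refl _ refl, rotated])
  then have "deriv (\<lambda>x. deriv (\<lambda>y. Fab a b \<phi> x y) t) s = (t ^ b / t) * (s ^ a / s) * dual_op a K s"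
    by (rule DERIV_imp_deriv)
  then show ?thesis
    using assms(2,3) by (simp add: tildeS_def powr_diff powr_realpow K_def)
qed

lemma tildeS_swap:
  assumes "vanishing2 R \<phi>" "s > 0" "t > 0"
  shows "tildeS b a (\<phi> \<circ> prod.swap) t s = tildeS a b \<phi> s t"
  using tildeS_eq[OF vanishing2_swap[OF assms(1)] assms(3,2)] tildeS_eq[OF assms] dual_op_swap[OF assms] by simp

text \<open>Each of the two operators costs a factor 2; the power of \<open>t\<close> produced by
  the inner one is a constant for the outer one.\<close>

lemma tildeS_bound:
  assumes \<phi>: "vanishing2 R \<phi>" and s: "s > 0" and t: "t > 0" and M: "\<And>u v. u \<ge> 0 \<Longrightarrow> v \<ge> 0 \<Longrightarrow> \<bar>\<phi> (u, v)\<bar> \<le> M"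
  shows "\<bar>s ^ a * t ^ b * tildeS a b \<phi> s t\<bar> \<le> 4 * M"
proof -
  have b: "\<bar>dual_op b (\<lambda>v. \<phi> (u, v)) t\<bar> \<le> 2 * M / t ^ b" if "u \<ge> s" for u
  proof -
    have "\<bar>t ^ b * dual_op b (\<lambda>v. \<phi> (u, v)) t\<bar> \<le> 2 * M"
      by (rule dual_op_bound[OF vanishing2_slice_snd[OF \<phi>] t]) (use s t that M in auto)
    then show ?thesis using t by (simp add: abs_mult field_simps)
  qed
  have "\<bar>s ^ a * dual_op a (\<lambda>u. dual_op b (\<lambda>v. \<phi> (u, v)) t) s\<bar> \<le> 2 * (2 * M / t ^ b)"
    by (rule dual_op_bound[OF vanishing_dual_op_snd[OF \<phi> t] s b])
  then show ?thesis using t s by (simp add: tildeS_eq[OF \<phi> s t] abs_mult field_simps)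
qed

lemma vanishing2_bounded:
  assumes "vanishing2 R \<phi>"
  shows "bdd_above ((\<lambda>x. \<bar>\<phi> x\<bar>) ` quadrant)"
proof -
  have "compact (\<phi> ` ({0..R} \<times> {0..R}))"
    by (rule compact_continuous_image)
       (use assms in \<open>auto simp: vanishing2_def quadrant_def intro: continuous_on_subset compact_Times\<close>)
  then have "bounded (\<phi> ` ({0..R} \<times> {0..R}))" by (rule compact_imp_bounded)
  then obtain B where B: "B > 0" "\<And>x. x \<in> {0..R} \<times> {0..R} \<Longrightarrow> \<bar>\<phi> x\<bar> \<le> B"
    unfolding bounded_pos by auto
  have "\<bar>\<phi> x\<bar> \<le> B" if "x \<in> quadrant" for x
  proof (cases "x \<in> {0..R} \<times> {0..R}")
    case False
    then have "\<phi> x = 0" using that assms by (cases x) (auto simp: vanishing2_def quadrant_def)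
    then show ?thesis using B by simp
  qed (rule B)
  then show ?thesis by (intro bdd_aboveI2)
qed

lemma vanishing2_maxnorm: "vanishing2 R \<phi> \<Longrightarrow> u \<ge> 0 \<Longrightarrow> v \<ge> 0 \<Longrightarrow> \<bar>\<phi> (u, v)\<bar> \<le> maxnorm \<phi>"
  unfolding maxnorm_def by (rule cSUP_upper[OF _ vanishing2_bounded]) (auto simp: quadrant_def)

lemma vanishing2_uniform:
  assumes \<phi>: "vanishing2 R \<phi>" and "e > 0"
  obtains d where "d > 0" "\<And>u v. 0 \<le> u \<Longrightarrow> u \<le> d \<Longrightarrow> 0 \<le> v \<Longrightarrow> \<bar>\<phi> (u, v) - \<phi> (0, v)\<bar> \<le> e"
proof -
  have "uniformly_continuous_on ({0..R} \<times> {0..R}) \<phi>"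
    by (rule compact_uniformly_continuous)
       (use \<phi> in \<open>auto simp: vanishing2_def quadrant_def intro: continuous_on_subset compact_Times\<close>)
  then obtain d where d: "d > 0" "\<And>x y. x \<in> {0..R} \<times> {0..R} \<Longrightarrow> y \<in> {0..R} \<times> {0..R} \<Longrightarrow> dist y x < d \<Longrightarrow> dist (\<phi> y) (\<phi> x) < e"
    using \<open>e > 0\<close> unfolding uniformly_continuous_on_def by metis
  show ?thesis
  proof
    \<comment> \<open>Staying below \<open>R\<close> keeps the point in the compact square; half of
      \<open>d\<close> makes the distance strictly smaller than \<open>d\<close>.\<close>
    show "min R (d / 2) > 0" using assms d by (simp add: vanishing2_def)
    fix u v :: real assume uv: "0 \<le> u" "u \<le> min R (d / 2)" "0 \<le> v"
    show "\<bar>\<phi> (u, v) - \<phi> (0, v)\<bar> \<le> e"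
    proof (cases "v \<le> R")
      case True
      have "dist (u, v) (0, v) < d" using uv d by (auto simp: dist_Pair_Pair dist_real_def)
      then have "dist (\<phi> (u, v)) (\<phi> (0, v)) < e"
        using uv True by (intro d(2)) auto
      then show ?thesis by (simp add: dist_real_def)
    next
      case False
      then show ?thesis using \<phi> uv assms by (simp add: vanishing2_def)
    qed
  qed
qed

text \<open>By \<open>power_dual_op_eq\<close> the expression is \<open>\<phi> (s, v)\<close> minus
  an average of the slice over \<open>u \<ge> s\<close>, and both approach
  \<open>\<phi> (0, v)\<close>, with errors \<open>e / 4\<close> and \<open>e / 2\<close>. The
  uniformity in \<open>v\<close> is what lets \<open>dual_op b\<close> be applied to the result
  afterwards.\<close>

lemma dual_op_uniform_limit:
  assumes \<phi>: "vanishing2 R \<phi>" and e: "e > 0" and a: "a \<ge> 1"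
  obtains d where "d > 0"
    "\<And>s v. 0 < s \<Longrightarrow> s \<le> d \<Longrightarrow> v \<ge> 0 \<Longrightarrow> \<bar>s ^ a * dual_op a (\<lambda>u. \<phi> (u, v)) s\<bar> \<le> e"
proof -
  obtain d where d: "d > 0" "\<And>u v. 0 \<le> u \<Longrightarrow> u \<le> d \<Longrightarrow> 0 \<le> v \<Longrightarrow> \<bar>\<phi> (u, v) - \<phi> (0, v)\<bar> \<le> e / 4"
    using vanishing2_uniform[OF \<phi>, of "e / 4"] e by auto
  define M where "M = max 1 (maxnorm \<phi>)"
  have M: "\<bar>\<phi> (u, v)\<bar> \<le> M" if "u \<ge> 0" "v \<ge> 0" for u v
    using vanishing2_maxnorm[OF \<phi> that] by (simp add: M_def)
  have M1: "M \<ge> 1" by (simp add: M_def)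
  obtain d' where d': "d' > 0" "d' \<le> d" "\<And>R f s. vanishing R f \<Longrightarrow> (\<And>u. u \<ge> 0 \<Longrightarrow> \<bar>f u\<bar> \<le> M)
       \<Longrightarrow> (\<And>u. 0 \<le> u \<Longrightarrow> u \<le> d \<Longrightarrow> \<bar>f u - f 0\<bar> \<le> e / 4) \<Longrightarrow> 0 < s \<Longrightarrow> s \<le> d'
       \<Longrightarrow> \<bar>real a * (s ^ a * tail_moment a f s) - f 0\<bar> \<le> 2 * (e / 4)"
    using tail_moment_near_zero_uniform[OF a M1, of "e / 4" d] e d(1) by (metis zero_less_divide_iff zero_less_numeral)
  have *: "\<bar>real a * (s ^ a * tail_moment a (\<lambda>u. \<phi> (u, v)) s) - \<phi> (0, v)\<bar> \<le> e / 2"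
    if "0 < s" "s \<le> d'" "v \<ge> 0" for s v
    using d'(3)[OF vanishing2_slice_fst[OF \<phi>], of v s] that d M by auto
  show ?thesis
  proof (rule that[OF d'(1)])
    fix s v :: real assume sv: "0 < s" "s \<le> d'" "v \<ge> 0"
    have "\<bar>\<phi> (s, v) - \<phi> (0, v)\<bar> \<le> e / 4" using sv d' by (intro d) auto
    then show "\<bar>s ^ a * dual_op a (\<lambda>u. \<phi> (u, v)) s\<bar> \<le> e"
      unfolding power_dual_op_eq[OF sv(1)] using *[OF sv] e by (simp only: abs_le_iff) linarith
  qed
qed

subsection \<open>Tail integrals and their dilation averages\<close>

text \<open>Continuity is asked on the open half-line only, since the radial profiles may be
  unbounded near 0.\<close>

definition vanishing_pos :: "real \<Rightarrow> (real \<Rightarrow> real) \<Rightarrow> bool" where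
  "vanishing_pos R Z \<longleftrightarrow> R > 0 \<and> continuous_on {0<..} Z \<and> (\<forall>r>R. Z r = 0)"

lemma tailint_eq:
  assumes "c \<ge> 1" "s > 0"
  shows "tailint (real c) Z s = integral {s..} (\<lambda>r. Z r * r ^ (c - 1))"
  unfolding tailint_def
proof (rule integral_cong)
  fix r assume "r \<in> {s..}"
  then have "r > 0" using assms by auto
  then have "r powr real (c - 1) = r ^ (c - 1)" by (rule powr_realpow)
  then show "Z r * r powr (real c - 1) = Z r * r ^ (c - 1)" using assms by (simp add: of_nat_diff)
qed

lemma tailint_deriv:
  assumes "vanishing_pos R Z" "c \<ge> 1" "s > 0"
  shows "(tailint (real c) Z has_real_derivative - (Z s * s ^ (c - 1))) (at s)"
proof -
  have "((\<lambda>s. integral {s..} (\<lambda>r. Z r * r ^ (c - 1))) has_real_derivative - (Z s * s ^ (c - 1))) (at s)"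
    by (rule integral_tail_deriv[where R = R])
       (use assms in \<open>auto simp: vanishing_pos_def intro!: continuous_intros\<close>)
  moreover have "\<forall>\<^sub>F x in nhds s. integral {x..} (\<lambda>r. Z r * r ^ (c - 1)) = tailint (real c) Z x"
    using eventually_nhds_in_open[of "{0<..}" s] assms(2,3)
    by (auto elim!: eventually_mono simp: tailint_eq)
  ultimately show ?thesis
    by (rule DERIV_cong_ev[THEN iffD1, OF refl _ refl, rotated])
qed

lemma tailint_zero:
  assumes "vanishing_pos R Z" "s \<ge> R"
  shows "tailint c Z s = 0"
proof -
  have "tailint c Z s = integral {s..s} (\<lambda>r. Z r * r powr (c - 1))"
    unfolding tailint_def by (rule integral_tail_cut) (use assms in \<open>auto simp: vanishing_pos_def\<close>)
  then show ?thesis by simp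
qed

lemma tailint_cont: "vanishing_pos R Z \<Longrightarrow> c \<ge> 1 \<Longrightarrow> continuous_on {0<..} (tailint (real c) Z)"
  by (intro DERIV_continuous_on[OF has_field_derivative_at_within[OF tailint_deriv]]) auto

text \<open>\<open>tailint c Z r + N * ln r\<close> is nondecreasing, its derivative being
  \<open>(N - r^c * Z r) / r\<close>.\<close>

lemma tailint_upper:
  assumes Z: "vanishing_pos R Z" and c: "c \<ge> 1" and s: "0 < s" "s \<le> t"
    and N: "\<And>r. s \<le> r \<Longrightarrow> r \<le> t \<Longrightarrow> r ^ c * Z r \<le> N"
  shows "tailint (real c) Z s - tailint (real c) Z t \<le> N * ln (t / s)"
proof -
  have "tailint (real c) Z s + N * ln s \<le> tailint (real c) Z t + N * ln t"
  proof (rule DERIV_nonneg_imp_nondecreasing[OF s(2)])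
    fix r assume r: "s \<le> r" "r \<le> t"
    then have r0: "r > 0" using s by auto
    have "((\<lambda>x. tailint (real c) Z x + N * ln x) has_real_derivative - (Z r * r ^ (c - 1)) + N * (1 / r)) (at r)"
      by (intro DERIV_add DERIV_cmult DERIV_ln_divide tailint_deriv[OF Z c] r0)
    moreover have "Z r * r ^ (c - 1) \<le> N * (1 / r)"
      using N[OF r] r0 c by (cases c) (auto simp: field_simps)
    ultimately show "\<exists>y. ((\<lambda>x. tailint (real c) Z x + N * ln x) has_real_derivative y) (at r) \<and> y \<ge> 0"
      by (intro exI[of _ "- (Z r * r ^ (c - 1)) + N * (1 / r)"]) auto
  qed
  then show ?thesis using s by (simp add: ln_div algebra_simps)
qed

lemma tailint_uminus: "tailint c (\<lambda>r. - Z r) s = - tailint c Z s"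
  by (simp add: tailint_def)

lemma tailint_diff_bound:
  assumes Z: "vanishing_pos R Z" and c: "c \<ge> 1" and s: "0 < s" "s \<le> t"
    and N: "\<And>r. s \<le> r \<Longrightarrow> r \<le> t \<Longrightarrow> \<bar>r ^ c * Z r\<bar> \<le> N"
  shows "\<bar>tailint (real c) Z s - tailint (real c) Z t\<bar> \<le> N * ln (t / s)"
proof -
  have "vanishing_pos R (\<lambda>r. - Z r)" using Z by (auto simp: vanishing_pos_def intro: continuous_intros)
  from tailint_upper[OF this c s] have "- tailint (real c) Z s + tailint (real c) Z t \<le> N * ln (t / s)"
    using N unfolding abs_le_iff by (simp add: tailint_uminus)
  moreover have "tailint (real c) Z s - tailint (real c) Z t \<le> N * ln (t / s)"
    by (rule tailint_upper[OF Z c s]) (use N in \<open>unfold abs_le_iff, simp\<close>)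
  ultimately show ?thesis by (simp add: abs_le_iff)
qed

section \<open>The angular weight of the dilation average\<close>

definition sec :: "real \<Rightarrow> real" where "sec x = sqrt (1 + x\<^sup>2)"

text \<open>In polar coordinates \<open>x = tan \<theta>\<close>, this is \<open>cos\<^sup>a\<^sup>-\<^sup>1 \<theta> sin\<^sup>b\<^sup>-\<^sup>1 \<theta> d\<theta>\<close>.\<close>

definition sector_weight :: "nat \<Rightarrow> nat \<Rightarrow> real \<Rightarrow> real" where
  "sector_weight a b x = x ^ (b - 1) / sec x ^ (a + b)"

lemma sec_ge: "sec x \<ge> 1" "sec x \<ge> x"
  unfolding sec_def by (auto intro!: real_le_rsqrt) 

lemma sec_pos: "sec x > 0" using sec_ge(1)[of x] by linarith

lemma sec_cont: "continuous_on S sec"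
  unfolding sec_def by (intro continuous_intros)

lemma sector_weight_cont: "continuous_on S (sector_weight a b)"
  unfolding sector_weight_def by (intro continuous_intros sec_cont) (use sec_pos in \<open>simp add: less_imp_neq[symmetric]\<close>)

lemma sector_weight_nonneg: "x \<ge> 0 \<Longrightarrow> sector_weight a b x \<ge> 0"
  using sec_pos[of x] by (simp add: sector_weight_def)

text \<open>By \<open>x \<le> sec x\<close> the weight is at most \<open>sec x\<close> to the power
  \<open>- a - 1\<close>, and \<open>a \<ge> 1\<close>.\<close>

lemma sector_weight_le:
  assumes "x \<ge> 0" "a \<ge> 1" "b \<ge> 1"
  shows "sector_weight a b x \<le> 1 / sec x ^ 2"
proof -
  have "x ^ (b - 1) * sec x ^ 2 \<le> sec x ^ (b - 1) * sec x ^ 2"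
    by (intro mult_right_mono power_mono sec_ge) (use assms in auto)
  also have "\<dots> = sec x ^ (b + 1)" using assms by (simp flip: power_add)
  also have "\<dots> \<le> sec x ^ (a + b)" by (rule power_increasing) (use assms sec_ge in auto)
  finally show ?thesis using sec_pos[of x] by (simp add: sector_weight_def field_simps)
qed

text \<open>The exponent \<open>- 3 / 2\<close> lies between \<open>- 2\<close>, the guaranteed
  decay of the weight, and \<open>- 1\<close>, the limit of integrability: the gap absorbs a factor
  \<open>ln (sec x)\<close>. The factor 2 comes from \<open>ln y \<le> 2 * sqrt y\<close>.\<close>

lemma sec_powr_integrable: "(\<lambda>x. 2 * sec x powr (- 3 / 2)) integrable_on {0..}"
proof -
  have c: "continuous_on S (\<lambda>x. 2 * sec x powr (- 3 / 2))" for S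
    using sec_pos by (intro continuous_intros sec_cont) (auto simp: less_imp_neq[symmetric])
  have "(\<lambda>x::real. x powr (- 3 / 2)) integrable_on {1..}"
    using has_integral_powr_to_inf[of "- 3 / 2" 1] by (auto simp: integrable_on_def)
  then have i: "(\<lambda>x::real. 2 * x powr (- 3 / 2)) integrable_on {1..}"
    by (rule integrable_on_mult_right)
  have "(\<lambda>x. 2 * sec x powr (- 3 / 2)) integrable_on {1..}"
  proof (rule measurable_bounded_by_integrable_imp_integrable[OF _ i])
    show "(\<lambda>x. 2 * sec x powr (- 3 / 2)) \<in> borel_measurable (lebesgue_on {1..})"
      by (rule continuous_imp_measurable_on_sets_lebesgue[OF c]) auto
    fix x :: real assume "x \<in> {1..}"
    then show "norm (2 * sec x powr (- 3 / 2)) \<le> 2 * x powr (- 3 / 2)"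
      using sec_ge(2)[of x] by (auto intro!: powr_mono2')
  qed auto
  moreover have "(\<lambda>x. 2 * sec x powr (- 3 / 2)) integrable_on {0..1}"
    by (rule integrable_continuous_interval[OF c])
  moreover have "{0..1::real} \<inter> {1..} = {1}" by auto
  ultimately have "(\<lambda>x. 2 * sec x powr (- 3 / 2)) integrable_on ({0..1} \<union> {1..})"
    by (intro integrable_Un) auto
  moreover have "{0..1::real} \<union> {1..} = {0..}" by auto
  ultimately show ?thesis by simp
qed

lemma sector_weight_dominated:
  assumes "x \<ge> 0" "a \<ge> 1" "b \<ge> 1"
  shows "sector_weight a b x \<le> 2 * sec x powr (- 3 / 2)" "sector_weight a b x * ln (sec x) \<le> 2 * sec x powr (- 3 / 2)"
proof -
  note p = sec_pos[of x]
  have sq: "1 / sec x ^ 2 = sec x powr (- 2)" using p by (simp add: powr_minus_divide)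
  have *: "1 / sec x ^ 2 \<le> sec x powr (- 3 / 2)"
    unfolding sq by (rule powr_mono) (use sec_ge in auto)
  show "sector_weight a b x \<le> 2 * sec x powr (- 3 / 2)"
    using sector_weight_le[OF assms] * powr_ge_zero[of "sec x" "- 3 / 2"] by linarith
  have "ln (sec x) = 2 * ln (sqrt (sec x))" using p by (simp add: ln_sqrt)
  also have "ln (sqrt (sec x)) \<le> sqrt (sec x)"
    using ln_le_minus_one[of "sqrt (sec x)"] p by simp
  finally have l: "ln (sec x) \<le> 2 * sec x powr (1 / 2)" using p by (simp add: powr_half_sqrt)
  have "sector_weight a b x * ln (sec x) \<le> (1 / sec x ^ 2) * (2 * sec x powr (1 / 2))"
    by (rule mult_mono[OF sector_weight_le[OF assms] l]) (use sec_ge in auto)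
  also have "\<dots> = 2 * (sec x powr (- 2) * sec x powr (1 / 2))"
    unfolding sq by simp
  also have "\<dots> = 2 * sec x powr (- 3 / 2)" by (simp only: powr_add[symmetric]) simp
  finally show "sector_weight a b x * ln (sec x) \<le> 2 * sec x powr (- 3 / 2)" .
qed

lemma sector_weight_integrable:
  assumes "a \<ge> 1" "b \<ge> 1"
  shows "sector_weight a b integrable_on {0..}"
proof (rule measurable_bounded_by_integrable_imp_integrable[OF _ sec_powr_integrable])
  show "sector_weight a b \<in> borel_measurable (lebesgue_on {0..})"
    by (rule continuous_imp_measurable_on_sets_lebesgue[OF sector_weight_cont]) auto
qed (use assms sector_weight_dominated(1) sector_weight_nonneg in auto)

text \<open>Positivity permits division by this mass later. The weight is nonnegative on the
  half-line, so a lower bound on \<open>{1..2}\<close> suffices.\<close>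

lemma sector_weight_integral_pos:
  assumes "a \<ge> 1" "b \<ge> 1"
  shows "integral {0..} (sector_weight a b) > 0"
proof -
  have "sector_weight a b x \<ge> 1 / 3 ^ (a + b)" if "x \<in> {1..2}" for x
  proof -
    have "sec x \<le> 3" unfolding sec_def using that power_mono[of x 2 2] by (intro real_le_lsqrt) auto
    then have "sec x ^ (a + b) \<le> 3 ^ (a + b)" using sec_pos[of x] by (intro power_mono) auto
    moreover have "x ^ (b - 1) \<ge> 1" using that by simp
    ultimately show ?thesis unfolding sector_weight_def using sec_pos[of x] by (intro frac_le) auto
  qed
  moreover have i: "sector_weight a b integrable_on {1..2}"
    by (rule integrable_continuous_interval[OF sector_weight_cont])
  ultimately have "integral {1..2::real} (\<lambda>_. 1 / 3 ^ (a + b)) \<le> integral {1..2} (sector_weight a b)"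
    by (intro integral_le) auto
  also have "\<dots> \<le> integral {0..} (sector_weight a b)"
    by (rule integral_subset_le) (use i sector_weight_integrable assms sector_weight_nonneg in auto)
  finally have "1 / 3 ^ (a + b) \<le> integral {0..} (sector_weight a b)" by simp
  moreover have "0 < 1 / (3::real) ^ (a + b)" by simp
  ultimately show ?thesis by linarith
qed

section \<open>Comparison of a tail integral with its dilation average\<close>

definition dilation_mean :: "nat \<Rightarrow> nat \<Rightarrow> (real \<Rightarrow> real) \<Rightarrow> real \<Rightarrow> real" where
  "dilation_mean a b Z s = integral {0..} (\<lambda>x. sector_weight a b x * tailint (real (a + b)) Z (s * sec x))"

text \<open>Since \<open>s * sec x \<ge> s * x\<close>, the integrand vanishes for
  \<open>x > R / s\<close>.\<close>

lemma dilation_mean_integrable: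
  assumes Z: "vanishing_pos R Z" and ab: "a \<ge> 1" "b \<ge> 1" and s: "s > 0"
  shows "(\<lambda>x. sector_weight a b x * tailint (real (a + b)) Z (s * sec x)) integrable_on {0..}"
proof (rule integrable_tail[where R = "R / s"])
  have c: "a + b \<ge> 1" using ab by simp
  show "continuous_on {0..} (\<lambda>x. sector_weight a b x * tailint (real (a + b)) Z (s * sec x))"
    by (intro continuous_intros sector_weight_cont continuous_on_compose2[OF tailint_cont[OF Z c]] sec_cont)
       (use s sec_pos in auto)
  fix x assume "x > R / s"
  then have "R < s * x" using s by (simp add: field_simps)
  also have "\<dots> \<le> s * sec x" using sec_ge(2)[of x] s by simp
  finally have "R \<le> s * sec x" by simp
  then show "sector_weight a b x * tailint (real (a + b)) Z (s * sec x) = 0" by (simp add: tailint_zero[OF Z])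
qed

lemma dilation_mean_diff:
  assumes Z: "vanishing_pos R Z" and ab: "a \<ge> 1" "b \<ge> 1" and s: "s > 0"
  shows "integral {0..} (sector_weight a b) * tailint (real (a + b)) Z s - dilation_mean a b Z s
    = integral {0..} (\<lambda>x. sector_weight a b x * (tailint (real (a + b)) Z s - tailint (real (a + b)) Z (s * sec x)))"
    and "(\<lambda>x. sector_weight a b x * (tailint (real (a + b)) Z s - tailint (real (a + b)) Z (s * sec x))) integrable_on {0..}"
proof -
  let ?D = "\<lambda>x. sector_weight a b x * (tailint (real (a + b)) Z s - tailint (real (a + b)) Z (s * sec x))"
  have i: "(\<lambda>x. sector_weight a b x * tailint (real (a + b)) Z s) integrable_on {0..}"
    by (rule integrable_on_mult_left[OF sector_weight_integrable[OF ab]])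
  show "integral {0..} (sector_weight a b) * tailint (real (a + b)) Z s - dilation_mean a b Z s = integral {0..} ?D"
    unfolding dilation_mean_def right_diff_distrib
    by (subst integral_diff[OF i dilation_mean_integrable[OF assms]]) simp
  show "?D integrable_on {0..}"
    unfolding right_diff_distrib by (rule integrable_diff[OF i dilation_mean_integrable[OF assms]])
qed

text \<open>Passing from \<open>s\<close> to \<open>s * sec x\<close> changes the tail integral by
  at most \<open>N * ln (sec x)\<close>. The resulting majorant does not involve \<open>s\<close>,
  so it serves both the uniform bound and dominated convergence as \<open>s\<close> tends to
  0.\<close>

lemma dilation_mean_diff_pointwise:
  assumes Z: "vanishing_pos R Z" and ab: "a \<ge> 1" "b \<ge> 1" and s: "s > 0"
    and N: "\<And>r. r > 0 \<Longrightarrow> \<bar>r ^ (a + b) * Z r\<bar> \<le> N" and x: "x \<ge> 0"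
  shows "\<bar>sector_weight a b x * (tailint (real (a + b)) Z s - tailint (real (a + b)) Z (s * sec x))\<bar>
     \<le> N * (2 * sec x powr (- 3 / 2))"
proof -
  have N0: "N \<ge> 0" using N[of 1] by auto
  have "\<bar>tailint (real (a + b)) Z s - tailint (real (a + b)) Z (s * sec x)\<bar> \<le> N * ln (s * sec x / s)"
    by (rule tailint_diff_bound[OF Z]) (use ab s sec_ge N in auto)
  then have "\<bar>sector_weight a b x * (tailint (real (a + b)) Z s - tailint (real (a + b)) Z (s * sec x))\<bar>
      \<le> sector_weight a b x * (N * ln (sec x))"
    using s sector_weight_nonneg[OF x, of a b] by (auto simp: abs_mult intro!: mult_left_mono)
  also have "\<dots> = N * (sector_weight a b x * ln (sec x))" by simp
  also have "\<dots> \<le> N * (2 * sec x powr (- 3 / 2))"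
    by (rule mult_left_mono[OF sector_weight_dominated(2)[OF x ab] N0])
  finally show ?thesis .
qed

lemma dilation_mean_diff_bound:
  assumes Z: "vanishing_pos R Z" and ab: "a \<ge> 1" "b \<ge> 1" and s: "s > 0"
    and N: "\<And>r. r > 0 \<Longrightarrow> \<bar>r ^ (a + b) * Z r\<bar> \<le> N"
  shows "\<bar>integral {0..} (sector_weight a b) * tailint (real (a + b)) Z s - dilation_mean a b Z s\<bar>
     \<le> N * integral {0..} (\<lambda>x. 2 * sec x powr (- 3 / 2))"
proof -
  have "norm (integral {0..} (\<lambda>x. sector_weight a b x * (tailint (real (a + b)) Z s - tailint (real (a + b)) Z (s * sec x))))
     \<le> integral {0..} (\<lambda>x. N * (2 * sec x powr (- 3 / 2)))"
    by (rule integral_norm_bound_integral[OF dilation_mean_diff(2)[OF Z ab s] integrable_on_mult_right[OF sec_powr_integrable]])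
       (use dilation_mean_diff_pointwise[OF assms] in auto)
  then show ?thesis by (simp only: dilation_mean_diff(1)[OF Z ab s] integral_mult_right real_norm_def)
qed

lemma tailint_dilation_tendsto:
  assumes Z: "vanishing_pos R Z" and c: "c \<ge> 1" and q: "q \<ge> 1"
    and lim: "((\<lambda>r. r ^ c * Z r) \<longlongrightarrow> 0) (at_right 0)"
  shows "((\<lambda>s. tailint (real c) Z s - tailint (real c) Z (s * q)) \<longlongrightarrow> 0) (at_right 0)"
proof (rule tendstoI)
  fix e :: real assume e: "e > 0"
  \<comment> \<open>As \<open>ln q \<le> q - 1 < q\<close>, this keeps \<open>N * ln q\<close> below
    \<open>e\<close>; dividing by \<open>q\<close> and not by \<open>ln q\<close> avoids a separate
    case \<open>q = 1\<close>.\<close>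
  define N where "N = e / (2 * q)"
  have N: "N > 0" using e q by (simp add: N_def)
  have "\<forall>\<^sub>F r in at_right 0. dist (r ^ c * Z r) 0 < N" by (rule tendstoD[OF lim N])
  then obtain d where d: "d > 0" "\<And>r. 0 < r \<Longrightarrow> r < d \<Longrightarrow> \<bar>r ^ c * Z r\<bar> < N"
    by (auto simp: eventually_at_right_field)
  have "\<forall>\<^sub>F s in at_right 0. s \<in> {0<..<d / q}"
    unfolding eventually_at_right_field using d(1) q by (intro exI[of _ "d / q"]) simp
  then show "\<forall>\<^sub>F s in at_right 0. dist (tailint (real c) Z s - tailint (real c) Z (s * q)) 0 < e"
  proof eventually_elim
    case (elim s)
    then have sq: "0 < s" "s * q < d" "s \<le> s * q" using q by (auto simp: field_simps)
    have "\<bar>tailint (real c) Z s - tailint (real c) Z (s * q)\<bar> \<le> N * ln (s * q / s)"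
    proof (rule tailint_diff_bound[OF Z c sq(1,3)])
      fix r assume "s \<le> r" "r \<le> s * q"
      then show "\<bar>r ^ c * Z r\<bar> \<le> N" using sq by (intro less_imp_le d(2)) auto
    qed
    also have "\<dots> \<le> N * q" using N sq q ln_le_minus_one[of q] by (intro mult_left_mono) auto
    also have "\<dots> < e" using e q by (simp add: N_def)
    finally show ?case by simp
  qed
qed

lemma dilation_mean_diff_tendsto:
  assumes Z: "vanishing_pos R Z" and ab: "a \<ge> 1" "b \<ge> 1"
    and N: "\<And>r. r > 0 \<Longrightarrow> \<bar>r ^ (a + b) * Z r\<bar> \<le> N"
    and lim: "((\<lambda>r. r ^ (a + b) * Z r) \<longlongrightarrow> 0) (at_right 0)"
  shows "((\<lambda>s. integral {0..} (sector_weight a b) * tailint (real (a + b)) Z s - dilation_mean a b Z s) \<longlongrightarrow> 0) (at_right 0)"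
\<comment> \<open>Dominated convergence speaks of sequences, so the limit at 0 is tested along
  sequences.\<close>
proof (rule tendsto_at_right_sequentially[of 0 1])
  fix X :: "nat \<Rightarrow> real"
  assume X: "\<And>n. 0 < X n" "X \<longlonglongrightarrow> 0"
  have X': "filterlim X (at_right 0) sequentially"
    using X by (auto intro!: tendsto_imp_filterlim_at_right)
  have "(\<lambda>n. integral {0..} (\<lambda>x. sector_weight a b x * (tailint (real (a + b)) Z (X n) - tailint (real (a + b)) Z (X n * sec x))))
    \<longlonglongrightarrow> integral {0..} (\<lambda>x::real. 0::real)"
  proof (rule dominated_convergence(2)[OF dilation_mean_diff(2)[OF Z ab X(1)] integrable_on_mult_right[OF sec_powr_integrable]])
    fix n and x :: real assume "x \<in> {0..}"
    then show "norm (sector_weight a b x * (tailint (real (a + b)) Z (X n) - tailint (real (a + b)) Z (X n * sec x)))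
        \<le> N * (2 * sec x powr (- 3 / 2))"
      using dilation_mean_diff_pointwise[OF Z ab X(1) N] by simp
  next
    fix x :: real
    have "(\<lambda>n. tailint (real (a + b)) Z (X n) - tailint (real (a + b)) Z (X n * sec x)) \<longlonglongrightarrow> 0"
      by (rule filterlim_compose[OF tailint_dilation_tendsto[OF Z _ sec_ge(1) lim] X']) (use ab in auto)
    from tendsto_mult[OF tendsto_const[of "sector_weight a b x"] this]
    show "(\<lambda>n. sector_weight a b x * (tailint (real (a + b)) Z (X n) - tailint (real (a + b)) Z (X n * sec x))) \<longlonglongrightarrow> 0"
      by (simp only: mult_zero_right)
  qed
  then show "(\<lambda>n. integral {0..} (sector_weight a b) * tailint (real (a + b)) Z (X n) - dilation_mean a b Z (X n)) \<longlonglongrightarrow> 0"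
    by (simp only: dilation_mean_diff(1)[OF Z ab X(1)] integral_0)
qed simp

subsection \<open>Radial images\<close>

text \<open>The radial profile is named, namely by its value at the diagonal point of the same
  radius, instead of being asserted to exist.\<close>

definition radial :: "nat \<Rightarrow> nat \<Rightarrow> (real \<times> real \<Rightarrow> real) \<Rightarrow> bool" where
  "radial a b \<phi> \<longleftrightarrow> (\<forall>s>0. \<forall>t>0. tildeS a b \<phi> s t = SS a b \<phi> (sqrt (s\<^sup>2 + t\<^sup>2)))"

lemma radial_dual_op:
  assumes "vanishing2 R \<phi>" "radial a b \<phi>" "s > 0" "t > 0"
  shows "dual_op b (\<lambda>v. dual_op a (\<lambda>u. \<phi> (u, v)) s) t = SS a b \<phi> (sqrt (s\<^sup>2 + t\<^sup>2))"
  using assms(2-) by (simp add: dual_op_swap[OF assms(1,3,4)] tildeS_eq[OF assms(1,3,4), symmetric] radial_def)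

text \<open>\<open>SS\<close> samples the diagonal, whose points of radius between \<open>R\<close>
  and \<open>sqrt 2 * R\<close> have both coordinates below \<open>R\<close>. Radiality allows any
  other point of the open quarter circle to be used instead.\<close>

lemma SS_vanishing_pos:
  assumes \<phi>: "vanishing2 R \<phi>" and rad: "radial a b \<phi>"
  shows "vanishing_pos R (SS a b \<phi>)"
proof -
  have R: "R > 0" using \<phi> by (simp add: vanishing2_def)
  have "SS a b \<phi> r = 0" if r: "r > R" for r
  proof -
    have pos: "r\<^sup>2 - R\<^sup>2 > 0" using r R power_strict_mono[of R r 2] by simp
    \<comment> \<open>The point \<open>(R, t)\<close> has radius \<open>r\<close>, and its first
      coordinate already forces the value 0.\<close>
    define t where "t = sqrt (r\<^sup>2 - R\<^sup>2)"
    have t: "t > 0" "sqrt (R\<^sup>2 + t\<^sup>2) = r" using pos r R by (auto simp: t_def)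
    have "dual_op b (\<lambda>v. dual_op a (\<lambda>u. \<phi> (u, v)) R) t = 0"
      using dual_op_swap[OF \<phi> R t(1), where a=a and b=b] dual_op_zero[OF vanishing_dual_op_snd[OF \<phi> t(1)], of R a b] by simp
    then show ?thesis using radial_dual_op[OF \<phi> rad R t(1)] t(2) by simp
  qed
  moreover have "isCont (SS a b \<phi>) r" if r: "r > 0" for r
  proof -
    \<comment> \<open>With the second coordinate frozen at \<open>t\<close>, the profile near
      \<open>r\<close> is \<open>dual_op a\<close> of a single function, composed with
      \<open>sqrt (x^2 - t^2)\<close>, which is continuous and positive for
      \<open>x > t\<close>.\<close>
    define t where "t = r / 2"
    have t: "t > 0" "t < r" using r by (auto simp: t_def)
    have q: "x\<^sup>2 - t\<^sup>2 > 0" if "x > t" for x using that t power_strict_mono[of t x 2] by simp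
    have "continuous_on {t<..} (\<lambda>x. dual_op a (\<lambda>u. dual_op b (\<lambda>v. \<phi> (u, v)) t) (sqrt (x\<^sup>2 - t\<^sup>2)))"
      by (rule continuous_on_compose2[OF dual_op_cont[OF vanishing_dual_op_snd[OF \<phi> t(1)]]])
         (use q in \<open>auto intro!: continuous_intros\<close>)
    also have "?this \<longleftrightarrow> continuous_on {t<..} (SS a b \<phi>)"
    proof (rule continuous_on_cong[OF refl])
      fix x assume x: "x \<in> {t<..}"
      show "dual_op a (\<lambda>u. dual_op b (\<lambda>v. \<phi> (u, v)) t) (sqrt (x\<^sup>2 - t\<^sup>2)) = SS a b \<phi> x"
        using radial_dual_op[OF \<phi> rad _ t(1), of "sqrt (x\<^sup>2 - t\<^sup>2)"] dual_op_swap[OF \<phi> _ t(1), of "sqrt (x\<^sup>2 - t\<^sup>2)"] q[of x] x t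
        by simp
    qed
    finally show ?thesis using t by (simp add: continuous_on_eq_continuous_at)
  qed
  ultimately show ?thesis using R by (auto simp: vanishing_pos_def intro: continuous_at_imp_continuous_on)
qed

lemma SS_bound:
  assumes \<phi>: "vanishing2 R \<phi>" and r: "r > 0"
  shows "\<bar>r ^ (a + b) * SS a b \<phi> r\<bar> \<le> 4 * sqrt 2 ^ (a + b) * maxnorm \<phi>"
proof -
  define s where "s = r / sqrt 2"
  have s: "s > 0" "r = s * sqrt 2" using r by (auto simp: s_def)
  have "\<bar>s ^ a * s ^ b * tildeS a b \<phi> s s\<bar> \<le> 4 * maxnorm \<phi>"
    by (rule tildeS_bound[OF \<phi> s(1) s(1)]) (rule vanishing2_maxnorm[OF \<phi>])
  then have "sqrt 2 ^ (a + b) * \<bar>s ^ a * s ^ b * tildeS a b \<phi> s s\<bar> \<le> sqrt 2 ^ (a + b) * (4 * maxnorm \<phi>)"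
    by (rule mult_left_mono) simp
  moreover have "SS a b \<phi> r = tildeS a b \<phi> s s" by (simp add: SS_def s_def)
  moreover have "\<bar>r ^ (a + b) * tildeS a b \<phi> s s\<bar> = sqrt 2 ^ (a + b) * \<bar>s ^ a * s ^ b * tildeS a b \<phi> s s\<bar>"
    using s by (simp add: power_mult_distrib power_add abs_mult)
  ultimately show ?thesis by (simp add: algebra_simps)
qed

text \<open>Smallness comes from the first variable, uniformly in the second; applying
  \<open>dual_op b\<close> then only costs a factor 2.\<close>

lemma SS_tendsto:
  assumes \<phi>: "vanishing2 R \<phi>" and a: "a \<ge> 1"
  shows "((\<lambda>r. r ^ (a + b) * SS a b \<phi> r) \<longlongrightarrow> 0) (at_right 0)"
proof (rule tendstoI)
  fix e :: real assume e: "e > 0"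
  \<comment> \<open>Of the factor 4, one 2 pays for \<open>dual_op b\<close> and the other leaves
    room for the strict inequality.\<close>
  define e' where "e' = e / (4 * sqrt 2 ^ (a + b))"
  have e': "e' > 0" using e by (simp add: e'_def)
  obtain d where d: "d > 0"
    "\<And>s v. 0 < s \<Longrightarrow> s \<le> d \<Longrightarrow> v \<ge> 0 \<Longrightarrow> \<bar>s ^ a * dual_op a (\<lambda>u. \<phi> (u, v)) s\<bar> \<le> e'"
    using dual_op_uniform_limit[OF \<phi> e' a] by metis
  have "\<forall>\<^sub>F r in at_right 0. r \<in> {0<..<d}"
    unfolding eventually_at_right_field using d(1) by (intro exI[of _ d]) simp
  then show "\<forall>\<^sub>F r in at_right 0. dist (r ^ (a + b) * SS a b \<phi> r) 0 < e"
  proof eventually_elim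
    case (elim r)
    define s where "s = r / sqrt 2"
    have s: "s > 0" "r = s * sqrt 2" using elim by (auto simp: s_def)
    have "s * 1 \<le> s * sqrt 2" by (rule mult_left_mono) (use s in auto)
    then have sd: "s \<le> d" using elim s(2) by (simp only: greaterThanLessThan_iff mult_1_right) linarith
    have "\<bar>dual_op a (\<lambda>u. \<phi> (u, v)) s\<bar> \<le> e' / s ^ a" if "v \<ge> s" for v
    proof -
      have "\<bar>s ^ a * dual_op a (\<lambda>u. \<phi> (u, v)) s\<bar> \<le> e'" using s sd that by (intro d(2)) auto
      then show ?thesis using s by (simp add: abs_mult field_simps)
    qed
    from dual_op_bound[OF vanishing_dual_op_fst[OF \<phi> s(1)] s(1) this, of b]
    have "\<bar>s ^ b * tildeS a b \<phi> s s\<bar> \<le> 2 * (e' / s ^ a)"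
      by (simp add: tildeS_eq[OF \<phi> s(1) s(1)] dual_op_swap[OF \<phi> s(1) s(1)])
    then have "\<bar>s ^ a * s ^ b * tildeS a b \<phi> s s\<bar> \<le> 2 * e'"
      using s by (simp add: abs_mult field_simps)
    then have "sqrt 2 ^ (a + b) * \<bar>s ^ a * s ^ b * tildeS a b \<phi> s s\<bar> \<le> sqrt 2 ^ (a + b) * (2 * e')"
      by (rule mult_left_mono) simp
    also have "\<dots> < e" using e by (simp add: e'_def)
    finally have "sqrt 2 ^ (a + b) * \<bar>s ^ a * s ^ b * tildeS a b \<phi> s s\<bar> < e" .
    moreover have "SS a b \<phi> r = tildeS a b \<phi> s s" by (simp add: SS_def s_def)
    moreover have "\<bar>r ^ (a + b) * tildeS a b \<phi> s s\<bar> = sqrt 2 ^ (a + b) * \<bar>s ^ a * s ^ b * tildeS a b \<phi> s s\<bar>"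
      using s by (simp add: power_mult_distrib power_add abs_mult)
    ultimately show ?case by simp
  qed
qed

text \<open>For \<open>b = 0\<close> the operator \<open>dual_op b\<close> is the identity, so
  radiality equates \<open>dual_op a\<close> of the slice at height \<open>v\<close> with the
  profile at \<open>sqrt (r^2 + v^2)\<close>; letting \<open>v\<close> tend to 0 identifies the
  profile.\<close>

lemma tailint_SS_zero:
  assumes \<phi>: "vanishing2 R \<phi>" and rad: "radial a 0 \<phi>" and a: "a \<ge> 1" and s: "s > 0"
  shows "tailint (real a) (SS a 0 \<phi>) s = s ^ a * tail_moment a (\<lambda>u. \<phi> (u, 0)) s"
proof -
  have *: "SS a 0 \<phi> r = dual_op a (\<lambda>u. \<phi> (u, 0)) r" if r: "r > 0" for r
  proof -
    have "((\<lambda>v. dual_op a (\<lambda>u. \<phi> (u, v)) r) \<longlongrightarrow> dual_op a (\<lambda>u. \<phi> (u, 0)) r) (at 0 within {0..})"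
      using vanishing_dual_op_fst[OF \<phi> r, of a] by (simp add: vanishing_def continuous_on_def)
    then have 1: "((\<lambda>v. dual_op a (\<lambda>u. \<phi> (u, v)) r) \<longlongrightarrow> dual_op a (\<lambda>u. \<phi> (u, 0)) r) (at_right 0)"
      by (rule tendsto_within_subset) auto
    have "isCont (SS a 0 \<phi>) r"
      using SS_vanishing_pos[OF \<phi> rad] r by (auto simp: vanishing_pos_def continuous_on_eq_continuous_at)
    moreover have "((\<lambda>v. sqrt (r\<^sup>2 + v\<^sup>2)) \<longlongrightarrow> sqrt (r\<^sup>2 + 0\<^sup>2)) (at_right 0)"
      by (intro tendsto_intros)
    ultimately have 2: "((\<lambda>v. SS a 0 \<phi> (sqrt (r\<^sup>2 + v\<^sup>2))) \<longlongrightarrow> SS a 0 \<phi> r) (at_right 0)"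
      using r by (auto intro: isCont_tendsto_compose)
    have "\<forall>\<^sub>F v in at_right 0. SS a 0 \<phi> (sqrt (r\<^sup>2 + v\<^sup>2)) = dual_op a (\<lambda>u. \<phi> (u, v)) r"
      using eventually_at_right_less[of "0::real"]
      by eventually_elim (use radial_dual_op[OF \<phi> rad r] in \<open>simp add: dual_op_def[of 0]\<close>)
    from tendsto_cong[THEN iffD1, OF this 2] 1 show ?thesis
      using tendsto_unique[OF trivial_limit_at_right_real] by blast
  qed
  have "tailint (real a) (SS a 0 \<phi>) s = integral {s..} (\<lambda>r. SS a 0 \<phi> r * r ^ (a - 1))"
    by (rule tailint_eq[OF a s])
  also have "\<dots> = integral {s..} (\<lambda>r. r ^ a / r * dual_op a (\<lambda>u. \<phi> (u, 0)) r)"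
  proof (rule integral_cong)
    fix r assume "r \<in> {s..}"
    then have "r > 0" using s by auto
    then show "SS a 0 \<phi> r * r ^ (a - 1) = r ^ a / r * dual_op a (\<lambda>u. \<phi> (u, 0)) r"
      unfolding *[OF \<open>r > 0\<close>] using a by (cases a) auto
  qed
  also have "\<dots> = s ^ a * tail_moment a (\<lambda>u. \<phi> (u, 0)) s"
    by (rule integral_dual_op[OF vanishing2_slice_fst[OF \<phi>] s]) simp
  finally show ?thesis .
qed

text \<open>By radiality the integrand is, up to sign, the derivative in \<open>x\<close> of
  \<open>v^b * tail_moment b h v\<close> at \<open>v = u * x\<close>, where \<open>h\<close> is
  \<open>dual_op a\<close> in the first variable at \<open>u\<close>. This antiderivative vanishes
  at \<open>u * K \<ge> R\<close> and tends to \<open>h 0 / b\<close> at 0.\<close>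

lemma radial_abel:
  assumes \<phi>: "vanishing2 R \<phi>" and rad: "radial a b \<phi>" and b: "b \<ge> 1" and u: "u > 0" and K: "K > 0" "u * K \<ge> R"
  shows "integral {0..K} (\<lambda>x. u ^ b * x ^ (b - 1) * SS a b \<phi> (u * sec x)) = dual_op a (\<lambda>x. \<phi> (x, 0)) u / real b"
proof -
  define h where "h = (\<lambda>v. dual_op a (\<lambda>x. \<phi> (x, v)) u)"
  have h: "vanishing R h" unfolding h_def by (rule vanishing_dual_op_fst[OF \<phi> u])
  \<comment> \<open>At \<open>x = 0\<close> the formula would give 0 because
    \<open>b \<ge> 1\<close>; inserting the limit \<open>h 0 / b\<close> makes \<open>Q\<close>
    continuous on \<open>{0..K}\<close>.\<close>
  define Q where "Q = (\<lambda>x. if x = 0 then h 0 / real b else (u * x) ^ b * tail_moment b h (u * x))"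
  have DQ: "(Q has_real_derivative - (u ^ b * x ^ (b - 1) * SS a b \<phi> (u * sec x))) (at x)" if x: "x > 0" for x
  proof -
    have ux: "u * x > 0" using u x by simp
    have "((\<lambda>x. (u * x) ^ b * tail_moment b h (u * x)) has_real_derivative
        - ((u * x) ^ b / (u * x) * dual_op b h (u * x)) * u) (at x)"
      by (rule DERIV_chain2[where g = "\<lambda>x. u * x", OF power_tail_moment_deriv[OF h ux, of b]]) (auto intro!: derivative_eq_intros)
    moreover have L: "dual_op b h (u * x) = SS a b \<phi> (u * sec x)"
    proof -
      have "sqrt (u\<^sup>2 + (u * x)\<^sup>2) = sqrt (u\<^sup>2 * (1 + x\<^sup>2))" by (simp add: algebra_simps)
      also have "\<dots> = u * sec x" using u by (simp add: real_sqrt_mult sec_def)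
      finally show ?thesis using radial_dual_op[OF \<phi> rad u ux] by (simp add: h_def)
    qed
    moreover have "- ((u * x) ^ b / (u * x) * dual_op b h (u * x)) * u = - (u ^ b * x ^ (b - 1) * SS a b \<phi> (u * sec x))"
      unfolding L using u x b by (cases b) (simp_all add: power_mult_distrib)
    ultimately have "((\<lambda>x. (u * x) ^ b * tail_moment b h (u * x)) has_real_derivative
        - (u ^ b * x ^ (b - 1) * SS a b \<phi> (u * sec x))) (at x)"
      by (simp only:)
    moreover have "\<forall>\<^sub>F y in nhds x. y \<in> {0<..}"
      by (rule eventually_nhds_in_open) (use x in auto)
    then have "\<forall>\<^sub>F y in nhds x. (u * y) ^ b * tail_moment b h (u * y) = Q y"
      by eventually_elim (simp add: Q_def)
    ultimately show ?thesis
      by (rule DERIV_cong_ev[THEN iffD1, OF refl _ refl, rotated])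
  qed
  have cont: "continuous_on {0..K} Q"
  proof (rule continuous_on_IccI)
    have "filterlim (\<lambda>x. u * x) (at_right 0) (at_right 0)"
      by (rule filterlim_times_pos[OF filterlim_ident u]) simp
    from filterlim_compose[OF tail_moment_tendsto[OF h b] this]
    have "((\<lambda>x. (u * x) ^ b * tail_moment b h (u * x)) \<longlongrightarrow> Q 0) (at_right 0)" by (simp add: Q_def)
    moreover have "\<forall>\<^sub>F x in at_right 0. (u * x) ^ b * tail_moment b h (u * x) = Q x"
      using eventually_at_right_less[of "0::real"] by eventually_elim (simp add: Q_def)
    ultimately show "(Q \<longlongrightarrow> Q 0) (at_right 0)" by (rule Lim_transform_eventually)
  next
    show "(Q \<longlongrightarrow> Q K) (at_left K)"
      using DERIV_isCont[OF DQ[OF K(1)]] by (auto simp: isCont_def intro: tendsto_within_subset)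
    show "Q \<midarrow>x\<rightarrow> Q x" if "0 < x" for x using DERIV_isCont[OF DQ[OF that]] by (simp add: isCont_def)
  qed (rule K)
  \<comment> \<open>At 0 only continuity of \<open>Q\<close> is at hand, hence the fundamental
    theorem with derivatives in the interior.\<close>
  have "((\<lambda>x. u ^ b * x ^ (b - 1) * SS a b \<phi> (u * sec x)) has_integral (- Q K - - Q 0)) {0..K}"
  proof (rule fundamental_theorem_of_calculus_interior)
    show "continuous_on {0..K} (\<lambda>x. - Q x)" by (intro continuous_intros cont)
    fix x assume "x \<in> {0<..<K}"
    then have "((\<lambda>x. - Q x) has_real_derivative - (- (u ^ b * x ^ (b - 1) * SS a b \<phi> (u * sec x)))) (at x)"
      by (intro DERIV_minus DQ) auto
    then show "((\<lambda>x. - Q x) has_vector_derivative u ^ b * x ^ (b - 1) * SS a b \<phi> (u * sec x)) (at x)"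
      by (simp add: has_real_derivative_iff_has_vector_derivative)
  qed (use K in auto)
  moreover have "Q K = 0" using K tail_moment_zero[OF h K(2)] by (simp add: Q_def)
  ultimately show ?thesis by (simp add: integral_unique Q_def h_def)
qed

text \<open>This is the substitution \<open>r = u * q\<close>, checked by differentiating;
  \<open>q \<ge> 1\<close> keeps \<open>u * q\<close> beyond \<open>R\<close> whenever
  \<open>u\<close> is.\<close>

lemma tailint_dilation:
  assumes Z: "vanishing_pos R Z" and c: "c \<ge> 1" and s: "s > 0" and q: "q \<ge> 1"
  shows "integral {s..R} (\<lambda>u. u ^ (c - 1) * Z (u * q)) = tailint (real c) Z (s * q) / q ^ c"
proof -
  have R: "R > 0" using Z by (simp add: vanishing_pos_def)
  have zero: "u * q > R" if "u > R" for u
  proof -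
    have "u * 1 \<le> u * q" by (rule mult_left_mono) (use that R q in auto)
    then show ?thesis using that by simp
  qed
  have "integral {s..} (\<lambda>u. u ^ (c - 1) * Z (u * q)) = tailint (real c) Z (s * q) / q ^ c"
  proof (rule integral_tail_eq[where R = R])
    fix u :: real assume u: "u > 0"
    have "((\<lambda>u. tailint (real c) Z (u * q)) has_real_derivative - (Z (u * q) * (u * q) ^ (c - 1)) * q) (at u)"
      by (rule DERIV_chain2[OF tailint_deriv[OF Z c]]) (use u q in \<open>auto intro!: derivative_eq_intros\<close>)
    from DERIV_cdivide[OF this, of "q ^ c"]
    show "((\<lambda>u. tailint (real c) Z (u * q) / q ^ c) has_real_derivative - (u ^ (c - 1) * Z (u * q))) (at u)"
      by (rule DERIV_cong) (use c q in \<open>cases c; simp add: field_simps\<close>)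
  next
    fix u :: real assume "u > R"
    from zero[OF this] show "u ^ (c - 1) * Z (u * q) = 0" "tailint (real c) Z (u * q) / q ^ c = 0"
      using Z tailint_zero[OF Z] by (auto simp: vanishing_pos_def)
  qed (rule s)
  moreover have "integral {s..} (\<lambda>u. u ^ (c - 1) * Z (u * q)) = integral {s..R} (\<lambda>u. u ^ (c - 1) * Z (u * q))"
    by (rule integral_tail_cut) (use zero Z in \<open>auto simp: vanishing_pos_def\<close>)
  ultimately show ?thesis by simp
qed

text \<open>Both sides are the weighted integral of the profile over the strip \<open>u > s\<close>.
  On the right \<open>x\<close> is integrated first, by \<open>radial_abel\<close>; on the left
  \<open>u\<close> first, by \<open>tailint_dilation\<close>, which leaves the angular
  weight.\<close>

lemma dilation_mean_SS:
  assumes \<phi>: "vanishing2 R \<phi>" and rad: "radial a b \<phi>" and ab: "a \<ge> 1" "b \<ge> 1" and s: "s > 0"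
  shows "dilation_mean a b (SS a b \<phi>) s = s ^ a * tail_moment a (\<lambda>u. \<phi> (u, 0)) s / real b"
proof -
  define Z where "Z = SS a b \<phi>"
  have Z: "vanishing_pos R Z" unfolding Z_def by (rule SS_vanishing_pos[OF \<phi> rad])
  have R: "R > 0" using Z by (simp add: vanishing_pos_def)
  \<comment> \<open>Every \<open>u \<ge> s\<close> satisfies \<open>u * K \<ge> R\<close>, so one
    end serves all \<open>u\<close>; the dilation average is cut there too, as
    \<open>s * sec x > R\<close> for \<open>x > K\<close>.\<close>
  define K where "K = R / s"
  have K: "K > 0" "s * K = R" using R s by (auto simp: K_def)
  have f: "vanishing R (\<lambda>u. \<phi> (u, 0))" by (rule vanishing2_slice_fst[OF \<phi>]) simp
  have "s ^ a * tail_moment a (\<lambda>u. \<phi> (u, 0)) s / real b = integral {s..} (\<lambda>u. u ^ a / u * dual_op a (\<lambda>u. \<phi> (u, 0)) u) / real b"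
    by (simp only: integral_dual_op[OF f s])
  also have "\<dots> = integral {s..} (\<lambda>u. u ^ a / u * dual_op a (\<lambda>u. \<phi> (u, 0)) u / real b)"
    by (simp only: integral_divide)
  also have "\<dots> = integral {s..R} (\<lambda>u. u ^ a / u * dual_op a (\<lambda>u. \<phi> (u, 0)) u / real b)"
    by (rule integral_tail_cut) (simp add: dual_op_zero[OF f])
  also have "\<dots> = integral {s..R} (\<lambda>u. integral {0..K} (\<lambda>x. u ^ (a + b - 1) * x ^ (b - 1) * Z (u * sec x)))"
  proof (rule integral_cong)
    fix u assume "u \<in> {s..R}"
    then have u: "u > 0" "u * K \<ge> R" using s K mult_right_mono[of s u K] by auto
    have "u ^ a / u * dual_op a (\<lambda>u. \<phi> (u, 0)) u / real b
      = u ^ a / u * integral {0..K} (\<lambda>x. u ^ b * x ^ (b - 1) * Z (u * sec x))"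
      unfolding Z_def radial_abel[OF \<phi> rad ab(2) u(1) K(1) u(2)] by simp
    also have "\<dots> = integral {0..K} (\<lambda>x. u ^ a / u * (u ^ b * x ^ (b - 1) * Z (u * sec x)))"
      by (simp only: integral_mult_right)
    also have "(\<lambda>x. u ^ a / u * (u ^ b * x ^ (b - 1) * Z (u * sec x))) = (\<lambda>x. u ^ (a + b - 1) * x ^ (b - 1) * Z (u * sec x))"
      using u ab by (cases a) (auto simp: power_add)
    finally show "u ^ a / u * dual_op a (\<lambda>u. \<phi> (u, 0)) u / real b
      = integral {0..K} (\<lambda>x. u ^ (a + b - 1) * x ^ (b - 1) * Z (u * sec x))" .
  qed
  also have "\<dots> = integral {0..K} (\<lambda>x. integral {s..R} (\<lambda>u. u ^ (a + b - 1) * x ^ (b - 1) * Z (u * sec x)))"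
  proof -
    \<comment> \<open>On the rectangle \<open>u * sec x \<ge> s > 0\<close>, so a singularity of
      \<open>Z\<close> at 0 is avoided.\<close>
    have "continuous_on (cbox (s, 0) (R, K)) (\<lambda>p. Z (fst p * sec (snd p)))"
      by (rule continuous_on_compose2[of "{0<..}" Z])
         (use Z s sec_pos in \<open>auto simp: vanishing_pos_def cbox_Pair_eq intro!: continuous_intros continuous_on_compose2[OF sec_cont[of UNIV]]\<close>)
    then have "continuous_on (cbox (s, 0) (R, K)) (\<lambda>(u, x). u ^ (a + b - 1) * x ^ (b - 1) * Z (u * sec x))"
      unfolding case_prod_unfold by (intro continuous_intros)
    from integral_swap_continuous[OF this] show ?thesis by simp
  qed
  also have "\<dots> = integral {0..K} (\<lambda>x. sector_weight a b x * tailint (real (a + b)) Z (s * sec x))"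
  proof (rule integral_cong)
    fix x :: real
    have "integral {s..R} (\<lambda>u. u ^ (a + b - 1) * x ^ (b - 1) * Z (u * sec x))
      = x ^ (b - 1) * integral {s..R} (\<lambda>u. u ^ (a + b - 1) * Z (u * sec x))"
      by (simp only: integral_mult_right[symmetric] mult_ac)
    also have "\<dots> = sector_weight a b x * tailint (real (a + b)) Z (s * sec x)"
      by (subst tailint_dilation[OF Z _ s sec_ge(1)]) (use ab in \<open>simp_all add: sector_weight_def\<close>)
    finally show "integral {s..R} (\<lambda>u. u ^ (a + b - 1) * x ^ (b - 1) * Z (u * sec x))
      = sector_weight a b x * tailint (real (a + b)) Z (s * sec x)" .
  qed
  also have "\<dots> = dilation_mean a b Z s"
    unfolding dilation_mean_def
  proof (rule integral_tail_cut[symmetric])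
    fix x assume "x > K"
    then have "R < s * x" using s K by (simp add: K_def field_simps)
    also have "\<dots> \<le> s * sec x" using sec_ge(2)[of x] s by simp
    finally show "sector_weight a b x * tailint (real (a + b)) Z (s * sec x) = 0" by (simp add: tailint_zero[OF Z])
  qed
  finally show ?thesis by (simp add: Z_def)
qed

text \<open>The constant depends on \<open>a\<close> and \<open>b\<close> only: for continuity it is
  applied to differences of functions, and must not vary with them.\<close>

lemma SS_tailint_fst:
  assumes a: "a \<ge> 1"
  shows "\<exists>C. \<forall>R \<phi>. vanishing2 R \<phi> \<longrightarrow> radial a b \<phi> \<longrightarrow>
    (\<forall>s>0. \<bar>tailint (real (a + b)) (SS a b \<phi>) s\<bar> \<le> C * maxnorm \<phi>) \<and>
    (\<exists>L. (tailint (real (a + b)) (SS a b \<phi>) \<longlongrightarrow> L) (at_right 0))"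
proof (cases "b = 0")
  case True
  show ?thesis
  proof (rule exI[of _ 1], intro allI impI conjI)
    fix R \<phi> assume \<phi>: "vanishing2 R \<phi>" and rad: "radial a b \<phi>"
    have f: "vanishing R (\<lambda>u. \<phi> (u, 0))" by (rule vanishing2_slice_fst[OF \<phi>]) simp
    have T: "tailint (real (a + b)) (SS a b \<phi>) s = s ^ a * tail_moment a (\<lambda>u. \<phi> (u, 0)) s" if "s > 0" for s
      using tailint_SS_zero[OF \<phi> _ a that] rad True by simp
    show "\<bar>tailint (real (a + b)) (SS a b \<phi>) s\<bar> \<le> 1 * maxnorm \<phi>" if s: "s > 0" for s
    proof -
      have "\<bar>real a * (s ^ a * tail_moment a (\<lambda>u. \<phi> (u, 0)) s)\<bar> \<le> maxnorm \<phi>"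
        by (rule tail_moment_bound[OF f s]) (use s vanishing2_maxnorm[OF \<phi>] in auto)
      moreover have "1 * \<bar>s ^ a * tail_moment a (\<lambda>u. \<phi> (u, 0)) s\<bar> \<le> real a * \<bar>s ^ a * tail_moment a (\<lambda>u. \<phi> (u, 0)) s\<bar>"
        by (rule mult_right_mono) (use a in auto)
      ultimately show ?thesis unfolding T[OF s] by (simp add: abs_mult)
    qed
    have "\<forall>\<^sub>F s in at_right 0. s ^ a * tail_moment a (\<lambda>u. \<phi> (u, 0)) s = tailint (real (a + b)) (SS a b \<phi>) s"
      using eventually_at_right_less[of "0::real"] by eventually_elim (simp only: T)
    from Lim_transform_eventually[OF tail_moment_tendsto[OF f a] this]
    show "\<exists>L. (tailint (real (a + b)) (SS a b \<phi>) \<longlongrightarrow> L) (at_right 0)" by blast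
  qed
next
  case False
  then have b: "b \<ge> 1" by simp
  define \<kappa> where "\<kappa> = integral {0..} (sector_weight a b)"
  have \<kappa>: "\<kappa> > 0" unfolding \<kappa>_def by (rule sector_weight_integral_pos[OF a b])
  define I where "I = integral {0..} (\<lambda>x. 2 * sec x powr (- 3 / 2))"
  show ?thesis
  \<comment> \<open>In units of the maximum norm, \<open>4 * sqrt 2 ^ (a + b) * I\<close> bounds the
    distance from \<open>\<kappa>\<close> times the tail integral to the dilation average, and 1
    bounds that average itself.\<close>
  proof (rule exI[of _ "(4 * sqrt 2 ^ (a + b) * I + 1) / \<kappa>"], intro allI impI conjI)
    fix R \<phi> assume \<phi>: "vanishing2 R \<phi>" and rad: "radial a b \<phi>"
    let ?T = "tailint (real (a + b)) (SS a b \<phi>)"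
    have f: "vanishing R (\<lambda>u. \<phi> (u, 0))" by (rule vanishing2_slice_fst[OF \<phi>]) simp
    note Z = SS_vanishing_pos[OF \<phi> rad]
    show "\<bar>?T s\<bar> \<le> (4 * sqrt 2 ^ (a + b) * I + 1) / \<kappa> * maxnorm \<phi>" if s: "s > 0" for s
    proof -
      have "\<bar>\<kappa> * ?T s - dilation_mean a b (SS a b \<phi>) s\<bar> \<le> 4 * sqrt 2 ^ (a + b) * maxnorm \<phi> * I"
        unfolding \<kappa>_def I_def by (rule dilation_mean_diff_bound[OF Z a b s SS_bound[OF \<phi>]])
      moreover have "\<bar>dilation_mean a b (SS a b \<phi>) s\<bar> \<le> maxnorm \<phi>"
      proof -
        have "\<bar>real a * (s ^ a * tail_moment a (\<lambda>u. \<phi> (u, 0)) s)\<bar> \<le> maxnorm \<phi>"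
          by (rule tail_moment_bound[OF f s]) (use s vanishing2_maxnorm[OF \<phi>] in auto)
        moreover have "1 * \<bar>dilation_mean a b (SS a b \<phi>) s\<bar> \<le> (real a * real b) * \<bar>dilation_mean a b (SS a b \<phi>) s\<bar>"
          by (rule mult_right_mono) (use mult_mono[of 1 "real a" 1 "real b"] a b in auto)
        moreover have "(real a * real b) * \<bar>dilation_mean a b (SS a b \<phi>) s\<bar> = \<bar>real a * (s ^ a * tail_moment a (\<lambda>u. \<phi> (u, 0)) s)\<bar>"
          unfolding dilation_mean_SS[OF \<phi> rad a b s] using b by (simp add: abs_mult abs_divide)
        ultimately show ?thesis by linarith
      qed
      ultimately have "\<bar>\<kappa> * ?T s\<bar> \<le> (4 * sqrt 2 ^ (a + b) * I + 1) * maxnorm \<phi>"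
        by (simp add: algebra_simps)
      then show ?thesis using \<kappa> by (simp add: abs_mult field_simps)
    qed
    have "\<forall>\<^sub>F s in at_right 0. s ^ a * tail_moment a (\<lambda>u. \<phi> (u, 0)) s / real b = dilation_mean a b (SS a b \<phi>) s"
      using eventually_at_right_less[of "0::real"] by eventually_elim (simp only: dilation_mean_SS[OF \<phi> rad a b])
    from Lim_transform_eventually[OF tendsto_divide[OF tail_moment_tendsto[OF f a] tendsto_const] this] b
    have "(dilation_mean a b (SS a b \<phi>) \<longlongrightarrow> \<phi> (0, 0) / real a / real b) (at_right 0)" by simp
    from tendsto_add[OF dilation_mean_diff_tendsto[OF Z a b SS_bound[OF \<phi>] SS_tendsto[OF \<phi> a]] this]
    have "((\<lambda>s. \<kappa> * ?T s) \<longlongrightarrow> 0 + \<phi> (0, 0) / real a / real b) (at_right 0)"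
      by (simp add: \<kappa>_def)
    from tendsto_divide[OF this tendsto_const[of \<kappa>]] \<kappa>
    show "\<exists>L. (?T \<longlongrightarrow> L) (at_right 0)" by auto
  qed
qed

section \<open>Exchange of the two variables\<close>

lemma SS_swap:
  assumes "vanishing2 R \<phi>" "r > 0"
  shows "SS b a (\<phi> \<circ> prod.swap) r = SS a b \<phi> r"
  unfolding SS_def by (rule tildeS_swap) (use assms in auto)

lemma radial_swap:
  assumes "vanishing2 R \<phi>" "radial a b \<phi>"
  shows "radial b a (\<phi> \<circ> prod.swap)"
  unfolding radial_def
proof (intro allI impI)
  fix s t :: real assume st: "s > 0" "t > 0"
  then have "sqrt (t\<^sup>2 + s\<^sup>2) > 0" by (simp add: pos_add_strict)
  then show "tildeS b a (\<phi> \<circ> prod.swap) s t = SS b a (\<phi> \<circ> prod.swap) (sqrt (s\<^sup>2 + t\<^sup>2))"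
    using assms(2) st tildeS_swap[OF assms(1) st(2,1)] SS_swap[OF assms(1)]
    by (simp add: radial_def add.commute)
qed

lemma maxnorm_swap: "maxnorm (\<phi> \<circ> prod.swap) = maxnorm \<phi>"
proof -
  have "prod.swap ` quadrant = quadrant" by (auto simp: quadrant_def image_iff)
  then have "(\<lambda>x. \<bar>(\<phi> \<circ> prod.swap) x\<bar>) ` quadrant = (\<lambda>x. \<bar>\<phi> x\<bar>) ` quadrant"
    by (metis (no_types, lifting) comp_apply image_cong image_image)
  then show ?thesis by (simp add: maxnorm_def)
qed

lemma tailint_cong:
  assumes "\<And>r. r > 0 \<Longrightarrow> Z r = Y r" "s > 0"
  shows "tailint c Z s = tailint c Y s"
  unfolding tailint_def by (rule integral_cong) (use assms in auto)

text \<open>If \<open>a = 0\<close> then \<open>b \<ge> 1\<close>, and swapping the variables puts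
  the positive exponent first.\<close>

lemma SS_tailint:
  assumes "a + b \<ge> 1"
  shows "\<exists>C. \<forall>R \<phi>. vanishing2 R \<phi> \<longrightarrow> radial a b \<phi> \<longrightarrow>
    (\<forall>s>0. \<bar>tailint (real (a + b)) (SS a b \<phi>) s\<bar> \<le> C * maxnorm \<phi>) \<and>
    (\<exists>L. (tailint (real (a + b)) (SS a b \<phi>) \<longlongrightarrow> L) (at_right 0)) \<and>
    ((\<lambda>r. r ^ (a + b) * SS a b \<phi> r) \<longlongrightarrow> 0) (at_right 0)"
proof (cases "a \<ge> 1")
  case True
  then show ?thesis using SS_tailint_fst[OF True, of b] SS_tendsto[OF _ True] by meson
next
  case False
  then have b: "b \<ge> 1" using assms by simp
  obtain C where C: "\<And>R \<phi>. vanishing2 R \<phi> \<Longrightarrow> radial b a \<phi> \<Longrightarrow>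
    (\<forall>s>0. \<bar>tailint (real (b + a)) (SS b a \<phi>) s\<bar> \<le> C * maxnorm \<phi>) \<and>
    (\<exists>L. (tailint (real (b + a)) (SS b a \<phi>) \<longlongrightarrow> L) (at_right 0))"
    using SS_tailint_fst[OF b, of a] by meson
  show ?thesis
  proof (intro exI[of _ C] allI impI)
    fix R \<phi> assume \<phi>: "vanishing2 R \<phi>" and rad: "radial a b \<phi>"
    let ?\<psi> = "\<phi> \<circ> prod.swap"
    note \<psi> = vanishing2_swap[OF \<phi>]
    note H = C[OF \<psi> radial_swap[OF \<phi> rad]]
    have T: "tailint (real (b + a)) (SS b a ?\<psi>) s = tailint (real (a + b)) (SS a b \<phi>) s" if "s > 0" for s
      unfolding add.commute[of b a] by (rule tailint_cong[OF SS_swap[OF \<phi>] that])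
    obtain L where L: "(tailint (real (b + a)) (SS b a ?\<psi>) \<longlongrightarrow> L) (at_right 0)" using H by blast
    have pos: "\<forall>\<^sub>F s in at_right 0. s > (0::real)" by (rule eventually_at_right_less)
    have 1: "\<forall>\<^sub>F s in at_right 0. tailint (real (b + a)) (SS b a ?\<psi>) s = tailint (real (a + b)) (SS a b \<phi>) s"
      using pos by eventually_elim (rule T)
    have 2: "\<forall>\<^sub>F r in at_right 0. r ^ (b + a) * SS b a ?\<psi> r = r ^ (a + b) * SS a b \<phi> r"
      using pos by eventually_elim (simp only: SS_swap[OF \<phi>] add.commute)
    show "(\<forall>s>0. \<bar>tailint (real (a + b)) (SS a b \<phi>) s\<bar> \<le> C * maxnorm \<phi>) \<and>
      (\<exists>L. (tailint (real (a + b)) (SS a b \<phi>) \<longlongrightarrow> L) (at_right 0)) \<and>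
      ((\<lambda>r. r ^ (a + b) * SS a b \<phi> r) \<longlongrightarrow> 0) (at_right 0)"
      using H T Lim_transform_eventually[OF L 1] Lim_transform_eventually[OF SS_tendsto[OF \<psi> b] 2]
      by (auto simp only: maxnorm_swap)
  qed
qed

section \<open>Elements of \<open>Cab\<close> and their differences\<close>

lemma Cab_vanishing2:
  assumes "\<phi> \<in> Cab a b R" "R > 0"
  shows "vanishing2 R \<phi>"
proof -
  have sub: "closure {x \<in> quadrant. \<phi> x \<noteq> 0} \<subseteq> ball 0 R"
    using assms(1) unfolding Cab_def mem_Collect_eq by (elim conjE)
  have cont: "continuous_on quadrant \<phi>"
    using assms(1) unfolding Cab_def mem_Collect_eq by (elim conjE)
  have "\<phi> (u, v) = 0" if uv: "u \<ge> 0" "v \<ge> 0" "u \<ge> R \<or> v \<ge> R" for u v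
  proof (rule ccontr)
    assume "\<phi> (u, v) \<noteq> 0"
    then have "(u, v) \<in> {x \<in> quadrant. \<phi> x \<noteq> 0}" using uv by (simp add: quadrant_def)
    then have "(u, v) \<in> ball 0 R" by (rule subsetD[OF sub subsetD[OF closure_subset]])
    then have "norm (u, v) < R" by simp
    moreover have "\<bar>u\<bar> \<le> norm (u, v)" "\<bar>v\<bar> \<le> norm (u, v)"
      using norm_fst_le[of u v] norm_snd_le[of v u] by auto
    ultimately show False using uv by auto
  qed
  then show ?thesis using cont assms(2) by (auto simp: vanishing2_def)
qed

text \<open>The diagonal point of radius \<open>sqrt (s^2 + t^2)\<close> has the same sum of squares
  as \<open>(s, t)\<close>, so \<open>g\<close> takes the same value there.\<close>

lemma Cab_radial:
  assumes "\<phi> \<in> Cab a b R"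
  shows "radial a b \<phi>"
proof -
  obtain g where g: "\<And>s t. s > 0 \<Longrightarrow> t > 0 \<Longrightarrow> tildeS a b \<phi> s t = g (s\<^sup>2 + t\<^sup>2)"
    using assms unfolding Cab_def mem_Collect_eq by (elim conjE exE) metis
  show ?thesis
    unfolding radial_def
  proof (intro allI impI)
    fix s t :: real assume st: "s > 0" "t > 0"
    then have "s\<^sup>2 + t\<^sup>2 > 0" by (simp add: pos_add_strict)
    then show "tildeS a b \<phi> s t = SS a b \<phi> (sqrt (s\<^sup>2 + t\<^sup>2))"
      using st by (simp add: SS_def g power_divide)
  qed
qed

lemma vanishing2_diff: "vanishing2 R \<phi> \<Longrightarrow> vanishing2 R \<psi> \<Longrightarrow> vanishing2 R (\<lambda>x. \<phi> x - \<psi> x)"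
  unfolding vanishing2_def by (auto intro!: continuous_intros)

text \<open>\<open>deriv\<close> respects differences only under differentiability, so linearity is
  read off from \<open>tildeS_eq\<close> and \<open>dual_op_lin\<close>.\<close>

lemma tildeS_diff:
  assumes \<phi>: "vanishing2 R \<phi>" and \<psi>: "vanishing2 R \<psi>" and st: "s > 0" "t > 0"
  shows "tildeS a b (\<lambda>x. \<phi> x - \<psi> x) s t = tildeS a b \<phi> s t - tildeS a b \<psi> s t"
proof -
  have diff: "dual_op c (\<lambda>u. f u - g u) x = dual_op c f x - dual_op c g x" if "vanishing R f" "vanishing R g" "x > 0" for c f g x
    using dual_op_lin[OF that, of c 1 "-1"] by simp
  have "dual_op a (\<lambda>u. dual_op b (\<lambda>v. \<phi> (u, v) - \<psi> (u, v)) t) s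
      = dual_op a (\<lambda>u. dual_op b (\<lambda>v. \<phi> (u, v)) t - dual_op b (\<lambda>v. \<psi> (u, v)) t) s"
  proof -
    \<comment> \<open>Inner linearity is available for slices with \<open>u \<ge> 0\<close>; the
      outer operator sees its argument on \<open>u \<ge> s\<close> alone.\<close>
    have *: "dual_op b (\<lambda>v. \<phi> (u, v) - \<psi> (u, v)) t = dual_op b (\<lambda>v. \<phi> (u, v)) t - dual_op b (\<lambda>v. \<psi> (u, v)) t"
      if "u \<ge> s" for u
      by (rule diff[OF vanishing2_slice_snd[OF \<phi>] vanishing2_slice_snd[OF \<psi>] st(2)]) (use that st in auto)
    have "tail_moment a (\<lambda>u. dual_op b (\<lambda>v. \<phi> (u, v) - \<psi> (u, v)) t) s
      = tail_moment a (\<lambda>u. dual_op b (\<lambda>v. \<phi> (u, v)) t - dual_op b (\<lambda>v. \<psi> (u, v)) t) s"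
      unfolding tail_moment_def by (rule integral_cong) (simp add: *)
    then show ?thesis unfolding dual_op_def[of a] by (simp add: *)
  qed
  also have "\<dots> = dual_op a (\<lambda>u. dual_op b (\<lambda>v. \<phi> (u, v)) t) s - dual_op a (\<lambda>u. dual_op b (\<lambda>v. \<psi> (u, v)) t) s"
    by (rule diff[OF vanishing_dual_op_snd[OF \<phi> st(2)] vanishing_dual_op_snd[OF \<psi> st(2)] st(1)])
  finally show ?thesis
    by (simp add: tildeS_eq[OF vanishing2_diff[OF \<phi> \<psi>] st] tildeS_eq[OF \<phi> st] tildeS_eq[OF \<psi> st])
qed

lemma SS_diff:
  assumes "vanishing2 R \<phi>" "vanishing2 R \<psi>" "r > 0"
  shows "SS a b (\<lambda>x. \<phi> x - \<psi> x) r = SS a b \<phi> r - SS a b \<psi> r"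
  unfolding SS_def by (rule tildeS_diff) (use assms in auto)

lemma radial_diff:
  assumes "vanishing2 R \<phi>" "vanishing2 R \<psi>" "radial a b \<phi>" "radial a b \<psi>"
  shows "radial a b (\<lambda>x. \<phi> x - \<psi> x)"
  unfolding radial_def
proof (intro allI impI)
  fix s t :: real assume st: "s > 0" "t > 0"
  then have "sqrt (s\<^sup>2 + t\<^sup>2) > 0" by (simp add: pos_add_strict)
  then show "tildeS a b (\<lambda>x. \<phi> x - \<psi> x) s t = SS a b (\<lambda>x. \<phi> x - \<psi> x) (sqrt (s\<^sup>2 + t\<^sup>2))"
    using assms(3,4) st by (simp add: tildeS_diff[OF assms(1,2)] SS_diff[OF assms(1,2)] radial_def)
qed

theorem theorem3p10:
  fixes a b :: nat and R :: real
  assumes "a + b \<ge> 1" and "R > 0"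
  shows "(\<forall>\<phi>\<in>Cab a b R. SS a b \<phi> \<in> D (real (a + b)) R)
       \<and> (\<forall>\<phi>\<in>Cab a b R. \<forall>\<epsilon>>0. \<exists>\<delta>>0. \<forall>\<psi>\<in>Cab a b R.
            maxnorm (\<lambda>x. \<phi> x - \<psi> x) < \<delta> \<longrightarrow>
            Dnorm (real (a + b)) (\<lambda>t. SS a b \<phi> t - SS a b \<psi> t) < \<epsilon>)"
proof -
  obtain C where C0: "\<And>R \<phi>. vanishing2 R \<phi> \<Longrightarrow> radial a b \<phi> \<Longrightarrow>
      (\<forall>s>0. \<bar>tailint (real (a + b)) (SS a b \<phi>) s\<bar> \<le> C * maxnorm \<phi>) \<and>
      (\<exists>L. (tailint (real (a + b)) (SS a b \<phi>) \<longlongrightarrow> L) (at_right 0)) \<and>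
      ((\<lambda>r. r ^ (a + b) * SS a b \<phi> r) \<longlongrightarrow> 0) (at_right 0)"
    using SS_tailint[OF assms(1)] by meson
  note C = C0[THEN conjunct1, rule_format] and L = C0[THEN conjunct2, THEN conjunct1]
    and Z = C0[THEN conjunct2, THEN conjunct2]
  have powr: "t powr real (a + b) = t ^ (a + b)" if "t > 0" for t :: real
    using that by (rule powr_realpow)
  have "SS a b \<phi> \<in> D (real (a + b)) R" if "\<phi> \<in> Cab a b R" for \<phi>
  proof -
    note ar = Cab_vanishing2[OF that assms(2)] Cab_radial[OF that]
    have "\<forall>\<^sub>F t in at_right 0. t ^ (a + b) * SS a b \<phi> t = t powr real (a + b) * SS a b \<phi> t"
      using eventually_at_right_less[of "0::real"] by eventually_elim (simp only: powr)
    from Lim_transform_eventually[OF Z[OF ar] this] L[OF ar] SS_vanishing_pos[OF ar]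
    show ?thesis unfolding D_def Cb_def vanishing_pos_def by blast
  qed
  moreover have "\<exists>\<delta>>0. \<forall>\<psi>\<in>Cab a b R. maxnorm (\<lambda>x. \<phi> x - \<psi> x) < \<delta> \<longrightarrow>
        Dnorm (real (a + b)) (\<lambda>t. SS a b \<phi> t - SS a b \<psi> t) < \<epsilon>"
    if \<phi>: "\<phi> \<in> Cab a b R" and \<epsilon>: "\<epsilon> > 0" for \<phi> \<epsilon>
  proof -
    \<comment> \<open>The summands bound the two suprema of \<open>Dnorm\<close> per unit of maximum
      norm. As the sign of \<open>C\<close> is unknown, \<open>\<bar>C\<bar>\<close> is taken; the
      first summand makes \<open>B\<close> positive, so that \<open>\<epsilon> / B\<close> can serve
      as \<open>\<delta>\<close>.\<close>
    define B where "B = 4 * sqrt 2 ^ (a + b) + \<bar>C\<bar>"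
    have "4 * sqrt 2 ^ (a + b) > (0::real)" by simp
    then have B: "B > 0" unfolding B_def by linarith
    have "Dnorm (real (a + b)) (\<lambda>t. SS a b \<phi> t - SS a b \<psi> t) < \<epsilon>"
      if \<psi>: "\<psi> \<in> Cab a b R" and lt: "maxnorm (\<lambda>x. \<phi> x - \<psi> x) < \<epsilon> / B" for \<psi>
    proof -
      note \<phi>a = Cab_vanishing2[OF \<phi> assms(2)] and \<psi>a = Cab_vanishing2[OF \<psi> assms(2)]
      note d = vanishing2_diff[OF \<phi>a \<psi>a] radial_diff[OF \<phi>a \<psi>a Cab_radial[OF \<phi>] Cab_radial[OF \<psi>]]
      let ?m = "maxnorm (\<lambda>x. \<phi> x - \<psi> x)"
      have m: "?m \<ge> 0" using vanishing2_maxnorm[OF d(1), of 0 0] by simp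
      have "(SUP t\<in>{0<..}. \<bar>t powr real (a + b) * (SS a b \<phi> t - SS a b \<psi> t)\<bar>) \<le> 4 * sqrt 2 ^ (a + b) * ?m"
      proof (rule cSUP_least)
        fix t :: real assume "t \<in> {0<..}"
        then have t: "t > 0" by simp
        show "\<bar>t powr real (a + b) * (SS a b \<phi> t - SS a b \<psi> t)\<bar> \<le> 4 * sqrt 2 ^ (a + b) * ?m"
          unfolding powr[OF t] SS_diff[OF \<phi>a \<psi>a t, symmetric] by (rule SS_bound[OF d(1) t])
      qed simp
      moreover have "(SUP t\<in>{0<..}. \<bar>tailint (real (a + b)) (\<lambda>t. SS a b \<phi> t - SS a b \<psi> t) t\<bar>) \<le> \<bar>C\<bar> * ?m"
      proof (rule cSUP_least)
        fix t :: real assume "t \<in> {0<..}"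
        then have t: "t > 0" by simp
        have "tailint (real (a + b)) (\<lambda>t. SS a b \<phi> t - SS a b \<psi> t) t
            = tailint (real (a + b)) (SS a b (\<lambda>x. \<phi> x - \<psi> x)) t"
          by (rule tailint_cong[OF SS_diff[OF \<phi>a \<psi>a, symmetric] t])
        then have "\<bar>tailint (real (a + b)) (\<lambda>t. SS a b \<phi> t - SS a b \<psi> t) t\<bar> \<le> C * ?m"
          using C[OF d t] by simp
        also have "\<dots> \<le> \<bar>C\<bar> * ?m" by (rule mult_right_mono[OF abs_ge_self m])
        finally show "\<bar>tailint (real (a + b)) (\<lambda>t. SS a b \<phi> t - SS a b \<psi> t) t\<bar> \<le> \<bar>C\<bar> * ?m" .
      qed simp
      ultimately have "Dnorm (real (a + b)) (\<lambda>t. SS a b \<phi> t - SS a b \<psi> t) \<le> B * ?m"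
        unfolding Dnorm_def B_def distrib_right by (rule add_mono)
      also have "\<dots> < \<epsilon>" using lt B by (simp add: field_simps)
      finally show ?thesis .
    qed
    then show ?thesis using B \<epsilon> by (intro exI[of _ "\<epsilon> / B"]) simp
  qed
  ultimately show ?thesis by blast
qed

end
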